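(* Let $F$ be a holomorphic Laplace pair $(\mu_l,\mu_r)$ on the vertical strip $\Omega_{a,b}$, $a<0<b$, with separatrix the imaginary axis $\Re(s)=0$ (so $F$ is holomorphic on all of $\Omega_{a,b}$, with no singularities on the separatrix), and suppose that $F$ satisfies the Phragmén–Lindelöf condition on $\Omega_{a,b}$. Then $\mu_l(t)=\mu_r(t)$ for all $t\in\mathbb{R}$.
   Context: For $-\infty\le\alpha<\beta\le+\infty$ put $\Omega_{\alpha,\beta}=\{s\in\mathbb{C}:\alpha<\Re(s)<\beta\}$. Determining functions: a function $\mu:\mathbb{R}\to\mathbb{C}$ of bounded variation on every finite interval is normalized if $\mu(0)=0$ and $\mu(t)=\frac{\mu(t^+)+\mu(t^-)}{2}$ for all $t\in\mathbb{R}$. All determining functions are assumed normalized. The bilateral Laplace–Stieltjes transform is $\mathcal{L}(\mu)(s)=\int_{-\infty}^{+\infty}e^{-st}\,d\mu(t)$ (a convergent improper integral). Laplace pair with separatrix $\Re(s)=0$: a function $F$, holomorphic or meromorphic on $\Omega_{a,b}$ with $a<0<b$, is a Laplace pair $(\mu_l,\mu_r)$ on $\Omega_{a,b}$ if $F(s)=\mathcal{L}(\mu_l)(s)$ for all $s\in\Omega_{a,0}$ and $F(s)=\mathcal{L}(\mu_r)(s)$ for all $s\in\Omega_{0,b}$, the integrals converging there. Phragmén–Lindelöf condition: a function $F$ meromorphic on $\Omega_{a,b}$ and continuous on the boundary satisfies it if there exist positive constants $A,B,Y$ and $0<K<\frac{\pi}{|b-a|}$ such that, for all $a<x<b$, $|F(x+iy)|\le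 A e^{Be^{K|y|}}$ whenever $|y|\ge Y$. *)

theory Defs
  imports "HOL-Complex_Analysis.Complex_Analysis"
begin

definition vertical_strip :: "ereal \<Rightarrow> ereal \<Rightarrow> complex set" where
  "vertical_strip \<alpha> \<beta> = {s. \<alpha> < ereal (Re s) \<and> ereal (Re s) < \<beta>}"

definition bounded_variation_on :: "(real \<Rightarrow> complex) \<Rightarrow> real set \<Rightarrow> bool" where
  "bounded_variation_on \<mu> S \<longleftrightarrow>
     (\<exists>B. \<forall>d. d division_of S \<longrightarrow> (\<Sum>k\<in>d. norm (\<mu> (Sup k) - \<mu> (Inf k))) \<le> B)"

definition normalized :: "(real \<Rightarrow> complex) \<Rightarrow> bool" where
  "normalized \<mu> \<longleftrightarrow> \<mu> 0 = 0 \<and>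
     (\<forall>t. \<exists>l r. (\<mu> \<longlongrightarrow> l) (at_left t) \<and> (\<mu> \<longlongrightarrow> r) (at_right t) \<and> \<mu> t = (r + l) / 2)"

definition determining_function :: "(real \<Rightarrow> complex) \<Rightarrow> bool" where
  "determining_function \<mu> \<longleftrightarrow> (\<forall>u v. bounded_variation_on \<mu> {u..v}) \<and> normalized \<mu>"

text \<open>The Riemann--Stieltjes integral of f with respect to \<open>\<mu>\<close> over \<open>{u..v}\<close>. The gauge has
  constant radius, so fineness says that the mesh tends to 0 (this is not a Henstock-type integral).\<close>

definition has_stieltjes_integral ::
  "(real \<Rightarrow> complex) \<Rightarrow> (real \<Rightarrow> complex) \<Rightarrow> real \<Rightarrow> real \<Rightarrow> complex \<Rightarrow> bool" where
  "has_stieltjes_integral f \<mu> u v I \<longleftrightarrow>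
     (\<forall>\<epsilon>>0. \<exists>\<delta>>0. \<forall>p. p tagged_division_of {u..v} \<and> (\<lambda>x. ball x \<delta>) fine p \<longrightarrow>
        norm ((\<Sum>(x, k)\<in>p. f x * (\<mu> (Sup k) - \<mu> (Inf k))) - I) < \<epsilon>)"

lemma has_stieltjes_integral_unique:
  assumes "has_stieltjes_integral f \<mu> u v I" "has_stieltjes_integral f \<mu> u v J"
  shows "I = J"
proof (rule ccontr)
  define S where "S p = (\<Sum>(x, k)\<in>p. f x * (\<mu> (Sup k) - \<mu> (Inf k)))" for p :: "(real \<times> real set) set"
  define \<epsilon> where "\<epsilon> = norm (I - J) / 2"
  assume "I \<noteq> J"
  then have "\<epsilon> > 0" by (simp add: \<epsilon>_def)
  obtain d where "d > 0"
    and d: "\<And>p. p tagged_division_of {u..v} \<Longrightarrow> (\<lambda>x. ball x d) fine p \<Longrightarrow> norm (S p - I) < \<epsilon>"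
    using assms(1)[unfolded has_stieltjes_integral_def, rule_format, OF \<open>\<epsilon> > 0\<close>]
    unfolding S_def by (elim exE conjE) simp
  obtain e where "e > 0"
    and e: "\<And>p. p tagged_division_of {u..v} \<Longrightarrow> (\<lambda>x. ball x e) fine p \<Longrightarrow> norm (S p - J) < \<epsilon>"
    using assms(2)[unfolded has_stieltjes_integral_def, rule_format, OF \<open>\<epsilon> > 0\<close>]
    unfolding S_def by (elim exE conjE) simp
  have "gauge (\<lambda>x::real. ball x d \<inter> ball x e)"
    using \<open>d > 0\<close> \<open>e > 0\<close> by (intro gauge_Int gauge_ball)
  then obtain p where p: "p tagged_division_of {u..v}" "(\<lambda>x. ball x d \<inter> ball x e) fine p"
    using fine_division_exists_real by blast
  have "norm (S p - I) < \<epsilon>" "norm (S p - J) < \<epsilon>"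
    using d[OF p(1)] e[OF p(1)] p(2) by (simp_all add: fine_Int)
  moreover have "norm (I - J) \<le> norm (S p - I) + norm (S p - J)"
    using norm_triangle_ineq4[of "S p - J" "S p - I"] by simp
  ultimately show False by (simp add: \<epsilon>_def)
qed

text \<open>\<open>has_laplace_stieltjes \<mu> s L\<close>: the improper integral \<open>\<L>(\<mu>)(s)\<close> converges, with value L.
  The two tails have to converge separately.\<close>

definition has_laplace_stieltjes :: "(real \<Rightarrow> complex) \<Rightarrow> complex \<Rightarrow> complex \<Rightarrow> bool" where
  "has_laplace_stieltjes \<mu> s L \<longleftrightarrow>
     (\<exists>G H l r.
        (\<forall>v\<ge>0. has_stieltjes_integral (\<lambda>t. exp (- s * of_real t)) \<mu> 0 v (G v)) \<and>
        (\<forall>u\<le>0. has_stieltjes_integral (\<lambda>t. exp (- s * of_real t)) \<mu> u 0 (H u)) \<and>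
        (G \<longlongrightarrow> r) at_top \<and> (H \<longlongrightarrow> l) at_bot \<and> L = l + r)"

text \<open>Laplace pairs with separatrix \<open>Re s = 0\<close>. The strip is open, so \<open>meromorphic_on\<close> covers
  the holomorphic case too.\<close>

definition laplace_pair ::
  "(complex \<Rightarrow> complex) \<Rightarrow> (real \<Rightarrow> complex) \<Rightarrow> (real \<Rightarrow> complex) \<Rightarrow> ereal \<Rightarrow> ereal \<Rightarrow> bool" where
  "laplace_pair F \<mu>\<^sub>l \<mu>\<^sub>r a b \<longleftrightarrow>
     a < 0 \<and> 0 < b \<and> F meromorphic_on vertical_strip a b \<and>
     determining_function \<mu>\<^sub>l \<and> determining_function \<mu>\<^sub>r \<and>
     (\<forall>s\<in>vertical_strip a 0. has_laplace_stieltjes \<mu>\<^sub>l s (F s)) \<and>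
     (\<forall>s\<in>vertical_strip 0 b. has_laplace_stieltjes \<mu>\<^sub>r s (F s))"

text \<open>Continuity on the boundary is that of F as a function on the closed strip, at the boundary
  points. For a strip of infinite width the bound on K is \<open>\<pi> / \<infinity> = 0\<close>, so the condition fails.\<close>

definition phragmen_lindelof :: "(complex \<Rightarrow> complex) \<Rightarrow> ereal \<Rightarrow> ereal \<Rightarrow> bool" where
  "phragmen_lindelof F a b \<longleftrightarrow>
     F meromorphic_on vertical_strip a b \<and>
     (\<forall>s\<in>frontier (vertical_strip a b). continuous (at s within closure (vertical_strip a b)) F) \<and>
     (\<exists>A B Y K :: real. A > 0 \<and> B > 0 \<and> Y > 0 \<and> 0 < K \<and> ereal K < ereal pi / \<bar>b - a\<bar> \<and>
        (\<forall>x y. a < ereal x \<and> ereal x < b \<and> \<bar>y\<bar> \<ge> Y \<longrightarrow>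
           norm (F (Complex x y)) \<le> A * exp (B * exp (K * \<bar>y\<bar>))))"

end

theory Submission
  imports Defs "HOL-Probability.Probability" "HOL-Real_Asymp.Real_Asymp"
begin

text \<open>For a vertical line \<open>Re s = c\<close> with \<open>c \<noteq> 0\<close> inside its half of the strip, a determining function
  \<open>\<mu>\<close> differs from a constant m (its limit at \<open>\<infinity>\<close> if \<open>c < 0\<close>, at \<open>-\<infinity>\<close> if \<open>c > 0\<close>) by
  \<open>O (exp (c t - \<kappa> \<bar>t\<bar>))\<close>, so that \<open>F s / s\<close> is the absolutely convergent bilateral Laplace integral of
  \<open>\<mu> - m\<close>. Hence F is \<open>O(\<bar>s\<bar>)\<close> on one line on each side of the imaginary axis, and by Phragmen--Lindelof
  in the strip between them. Integrating \<open>exp (\<sigma>\<^sup>2 s\<^sup>2 / 2 + s t) F s / s\<close> along a line recovers the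
  convolution of \<open>\<mu> - m\<close> with a Gaussian density. Moving the line across the simple pole at 0 changes this
  convolution by \<open>F 0\<close>, whatever t and \<open>\<sigma>\<close>. As \<open>\<sigma>\<close> tends to 0 the convolutions converge to
  \<open>\<mu> - m\<close> at every point because \<open>\<mu>\<close> is normalized, so the two determining functions differ by a constant,
  which vanishes because both are 0 at 0.\<close>

section \<open>Integration by parts for Riemann--Stieltjes integrals\<close>

text \<open>The obstacle is that the transforms may converge only conditionally and that \<mu> has
  finite variation only on bounded intervals, so there is no finite weighted measure to work with;
  every estimate has to pass through integration by parts. Convergence at a single real point
  controls \<open>\<mu> - m\<close> only up to a factor \<open>1 + \<bar>t\<bar>\<close>. Two real
  points p < c < q on the same side of the axis pay for it on the line through c: p serves for t >=
  0 and q for t <= 0. On such a line \<open>F s / s\<close> is merely bounded, so an unweighted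
  inversion integral need not converge absolutely; the Gaussian factor supplies the decay for Fubini
  and for the horizontal sides of the contour. Its decay is no match for doubly exponential growth,
  hence the linear bound on F has to be available before the line is moved. The constants on the two
  sides differ in general: they are limits at opposite ends, and their difference \<open>F 0\<close>
  is the total mass of the common Stieltjes differential.\<close>

definition midpoint_regular :: "(real \<Rightarrow> complex) \<Rightarrow> bool" where
  "midpoint_regular \<mu> \<longleftrightarrow>
     (\<forall>t. \<exists>l r. (\<mu> \<longlongrightarrow> l) (at_left t) \<and> (\<mu> \<longlongrightarrow> r) (at_right t) \<and> \<mu> t = (r + l) / 2)"

text \<open>The midpoint condition enters through this limit twice: with the two neighbouring grid
  points, and with the points \<open>t - \<sigma> z\<close> and \<open>t + \<sigma> z\<close> under
  a Gaussian.\<close>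

lemma midpoint_regular_limit:
  assumes "midpoint_regular \<mu>" "filterlim l (at_left t) F" "filterlim r (at_right t) F"
  shows "((\<lambda>n. (\<mu> (l n) + \<mu> (r n)) / 2) \<longlongrightarrow> \<mu> t) F"
proof -
  obtain L R where L: "(\<mu> \<longlongrightarrow> L) (at_left t)" and R: "(\<mu> \<longlongrightarrow> R) (at_right t)"
    and m: "\<mu> t = (R + L) / 2"
    using assms(1) unfolding midpoint_regular_def by blast
  have "((\<lambda>n. (\<mu> (l n) + \<mu> (r n)) / 2) \<longlongrightarrow> (L + R) / 2) F"
    by (intro tendsto_intros filterlim_compose[OF L assms(2)] filterlim_compose[OF R assms(3)]) simp
  then show ?thesis by (simp add: m add.commute)
qed

text \<open>The reason for separating the midpoint condition from \<open>\<mu> 0 = 0\<close>: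
  \<open>\<mu> - m\<close> keeps the former but in general not the latter.\<close>

lemma midpoint_regular_diff_const:
  assumes "midpoint_regular \<mu>"
  shows "midpoint_regular (\<lambda>t. \<mu> t - m)"
  unfolding midpoint_regular_def
proof
  fix t
  obtain L R where L: "(\<mu> \<longlongrightarrow> L) (at_left t)" and R: "(\<mu> \<longlongrightarrow> R) (at_right t)"
    and m: "\<mu> t = (R + L) / 2"
    using assms(1) unfolding midpoint_regular_def by blast
  show "\<exists>l r. ((\<lambda>t. \<mu> t - m) \<longlongrightarrow> l) (at_left t) \<and> ((\<lambda>t. \<mu> t - m) \<longlongrightarrow> r) (at_right t) \<and>
       \<mu> t - m = (r + l) / 2"
    by (intro exI[of _ "L - m"] exI[of _ "R - m"] conjI tendsto_intros L R) (simp add: m field_simps)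
qed

text \<open>Averaging the values at the two neighbouring grid points, instead of sampling on one side, makes
  the step functions converge to \<open>\<mu>\<close> at the jumps too. It corresponds to averaging the Riemann--Stieltjes
  sums with left and with right tags. For t on the grid the neighbours are those strictly to the left
  and to the right of t.\<close>

definition grid_left :: "real \<Rightarrow> real \<Rightarrow> real \<Rightarrow> real" where
  "grid_left u h t = u + h * (of_int \<lceil>(t - u) / h\<rceil> - 1)"

definition grid_right :: "real \<Rightarrow> real \<Rightarrow> real \<Rightarrow> real" where
  "grid_right u h t = u + h * (of_int \<lfloor>(t - u) / h\<rfloor> + 1)"

definition grid_average :: "(real \<Rightarrow> complex) \<Rightarrow> real \<Rightarrow> real \<Rightarrow> real \<Rightarrow> complex" where
  "grid_average \<mu> u h t = (\<mu> (grid_left u h t) + \<mu> (grid_right u h t)) / 2"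

lemma grid_left_bounds:
  assumes "h > 0"
  shows "t - h \<le> grid_left u h t" "grid_left u h t < t"
proof -
  have t: "t = u + h * ((t - u) / h)" using assms by simp
  have "(t - u) / h \<le> of_int \<lceil>(t - u) / h\<rceil>" "of_int \<lceil>(t - u) / h\<rceil> - 1 < (t - u) / h"
    by linarith+
  from this(1)[THEN mult_left_mono[OF _ less_imp_le[OF assms]]] this(2)[THEN mult_strict_left_mono[OF _ assms]] t
  show "t - h \<le> grid_left u h t" "grid_left u h t < t"
    unfolding grid_left_def right_diff_distrib distrib_left mult_1_right by linarith+
qed

lemma grid_right_bounds:
  assumes "h > 0"
  shows "t < grid_right u h t" "grid_right u h t \<le> t + h"
proof -
  have t: "t = u + h * ((t - u) / h)" using assms by simp
  have "of_int \<lfloor>(t - u) / h\<rfloor> \<le> (t - u) / h" "(t - u) / h < of_int \<lfloor>(t - u) / h\<rfloor> + 1"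
    by linarith+
  from this(1)[THEN mult_left_mono[OF _ less_imp_le[OF assms]]] this(2)[THEN mult_strict_left_mono[OF _ assms]] t
  show "t < grid_right u h t" "grid_right u h t \<le> t + h"
    unfolding grid_right_def right_diff_distrib distrib_left mult_1_right by linarith+
qed

lemma grid_average_tendsto:
  assumes "midpoint_regular \<mu>" "\<And>n. h n > 0" "h \<longlonglongrightarrow> 0"
  shows "(\<lambda>n. grid_average \<mu> u (h n) t) \<longlonglongrightarrow> \<mu> t"
  unfolding grid_average_def
proof (rule midpoint_regular_limit[OF assms(1)])
  have "(\<lambda>n. t - h n) \<longlonglongrightarrow> t" "(\<lambda>n. t + h n) \<longlonglongrightarrow> t"
    using tendsto_diff[OF tendsto_const assms(3), of t] tendsto_add[OF tendsto_const assms(3), of t] by simp_all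
  note lim = this
  have "(\<lambda>n. grid_left u (h n) t) \<longlonglongrightarrow> t"
    by (rule tendsto_sandwich[OF _ _ lim(1) tendsto_const])
       (simp_all add: assms(2) grid_left_bounds less_imp_le)
  moreover have "(\<lambda>n. grid_right u (h n) t) \<longlonglongrightarrow> t"
    by (rule tendsto_sandwich[OF _ _ tendsto_const lim(2)])
       (simp_all add: assms(2) grid_right_bounds less_imp_le)
  ultimately show "filterlim (\<lambda>n. grid_left u (h n) t) (at_left t) sequentially"
    "filterlim (\<lambda>n. grid_right u (h n) t) (at_right t) sequentially"
    unfolding filterlim_at using assms(2)
    by (auto simp: grid_left_bounds grid_right_bounds less_imp_neq less_imp_neq[symmetric])
qed

text \<open>Pointwise limit of grid averages, which are measurable for any \<mu> because they factor
  through the integer-valued floor and ceiling.\<close>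

lemma midpoint_regular_borel_measurable:
  assumes "midpoint_regular \<mu>"
  shows "\<mu> \<in> borel_measurable borel"
proof (rule borel_measurable_LIMSEQ_metric)
  show "(\<lambda>t. grid_average \<mu> 0 (1 / real (Suc n)) t) \<in> borel_measurable borel" for n
    unfolding grid_average_def grid_left_def grid_right_def
  proof (intro borel_measurable_divide borel_measurable_add borel_measurable_const)
    show "(\<lambda>x. \<mu> (0 + 1 / real (Suc n) * (of_int \<lceil>(x - 0) / (1 / real (Suc n))\<rceil> - 1)))
        \<in> borel_measurable borel"
      by (rule measurable_compose[of "\<lambda>x. \<lceil>(x - 0) / (1 / real (Suc n))\<rceil>" borel "count_space UNIV"
            "\<lambda>k. \<mu> (0 + 1 / real (Suc n) * (of_int k - 1))"]) measurable
    show "(\<lambda>x. \<mu> (0 + 1 / real (Suc n) * (of_int \<lfloor>(x - 0) / (1 / real (Suc n))\<rfloor> + 1)))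
        \<in> borel_measurable borel"
      by (rule measurable_compose[of "\<lambda>x. \<lfloor>(x - 0) / (1 / real (Suc n))\<rfloor>" borel "count_space UNIV"
            "\<lambda>k. \<mu> (0 + 1 / real (Suc n) * (of_int k + 1))"]) measurable
  qed
  show "(\<lambda>n. grid_average \<mu> 0 (1 / real (Suc n)) t) \<longlonglongrightarrow> \<mu> t" for t
    by (intro grid_average_tendsto[OF assms]) (use LIMSEQ_inverse_real_of_nat in \<open>simp_all add: inverse_eq_divide\<close>)
qed

lemma bounded_variation_on_imp_bounded:
  assumes "bounded_variation_on \<mu> {u..v}"
  shows "bounded (\<mu> ` {u..v})"
proof -
  obtain B where B: "\<And>d. d division_of {u..v} \<Longrightarrow> (\<Sum>k\<in>d. norm (\<mu> (Sup k) - \<mu> (Inf k))) \<le> B"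
    using assms unfolding bounded_variation_on_def by blast
  have "norm (\<mu> t) \<le> norm (\<mu> u) + norm (\<mu> v) + B" if t: "t \<in> {u..v}" for t
  proof -
    have "B \<ge> 0"
      using B[of "{{u..v}}"] t division_of_self[of u v] order_trans[OF norm_ge_zero] by auto
    consider "t = u" | "t = v" | "u < t" "t < v" using t by fastforce
    then show ?thesis
    proof cases
      case 3
      have "{{u..t}, {t..v}} division_of {u..v}"
      proof -
        have "({{u..t}} \<union> {{t..v}}) division_of ({u..t} \<union> {t..v})"
          using 3 by (intro division_disjoint_union) (use division_of_self[of u t] division_of_self[of t v] in auto)
        also have "{u..t} \<union> {t..v} = {u..v}" using 3 by auto
        finally show ?thesis by (simp add: insert_commute)
      qed
      from B[OF this] have "norm (\<mu> t - \<mu> u) + norm (\<mu> v - \<mu> t) \<le> B"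
        using 3 by (subst (asm) sum.insert) (simp_all add: Icc_eq_Icc)
      then show ?thesis
        using norm_triangle_ineq2[of "\<mu> t" "\<mu> u"] norm_ge_zero[of "\<mu> v - \<mu> t"] norm_ge_zero[of "\<mu> v"]
        by linarith
    qed (use \<open>B \<ge> 0\<close> in auto)
  qed
  then show ?thesis unfolding bounded_iff by blast
qed

section \<open>Equidistant Riemann--Stieltjes sums and the trapezoidal rule\<close>

lemma uniform_tagged_division:
  fixes u h :: real and \<tau> :: "nat \<Rightarrow> real"
  assumes "h > 0" "n > 0" "\<And>i. \<tau> i \<in> {u + real i * h..u + real (Suc i) * h}"
  shows "(\<lambda>i. (\<tau> i, {u + real i * h..u + real (Suc i) * h})) ` {..<n}
           tagged_division_of {u..u + real n * h}"
  using \<open>n > 0\<close>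
proof (induction n rule: nat_induct_non_zero)
  case 1
  then show ?case
    using tagged_division_of_self_real[OF assms(3)[of 0]] by (simp add: lessThan_Suc)
next
  case (Suc n)
  have eq: "{u..u + real n * h} \<union> {u + real n * h..u + real (Suc n) * h} = {u..u + real (Suc n) * h}"
    using assms(1) by (intro ivl_disj_un_two_touch) (auto simp: algebra_simps)
  show ?case
    using tagged_division_Un[OF Suc.IH tagged_division_of_self_real[OF assms(3)[of n]]] eq
    by (simp add: lessThan_Suc Un_commute)
qed

text \<open>The tags stay arbitrary within their cells because both the left and the right end
  points are used as tags in the integration by parts.\<close>

lemma stieltjes_uniform_sums:
  fixes \<tau> :: "nat \<Rightarrow> nat \<Rightarrow> real"
  assumes "has_stieltjes_integral e \<mu> u v I" "u < v"
    and \<tau>: "\<And>n i. \<tau> n i \<in> {u + real i * ((v - u) / real (Suc n))..u + real (Suc i) * ((v - u) / real (Suc n))}"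
  shows "(\<lambda>n. \<Sum>i<Suc n. e (\<tau> n i) * (\<mu> (u + real (Suc i) * ((v - u) / real (Suc n))) -
            \<mu> (u + real i * ((v - u) / real (Suc n))))) \<longlonglongrightarrow> I"
proof (rule LIMSEQ_I)
  fix r :: real assume "r > 0"
  then obtain \<delta> where "\<delta> > 0" and \<delta>: "\<And>p. p tagged_division_of {u..v} \<Longrightarrow> (\<lambda>x. ball x \<delta>) fine p \<Longrightarrow>
        norm ((\<Sum>(x, k)\<in>p. e x * (\<mu> (Sup k) - \<mu> (Inf k))) - I) < r"
    using assms(1) unfolding has_stieltjes_integral_def by meson
  have "(\<lambda>n. (v - u) / real (Suc n)) \<longlonglongrightarrow> 0"
    by (rule real_tendsto_divide_at_top[OF tendsto_const])
       (intro filterlim_compose[OF filterlim_real_sequentially filterlim_Suc])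
  from order_tendstoD(2)[OF this \<open>\<delta> > 0\<close>]
  obtain N where N: "\<And>n. n \<ge> N \<Longrightarrow> (v - u) / real (Suc n) < \<delta>"
    unfolding eventually_sequentially by meson
  show "\<exists>N. \<forall>n\<ge>N. norm ((\<Sum>i<Suc n. e (\<tau> n i) * (\<mu> (u + real (Suc i) * ((v - u) / real (Suc n))) -
            \<mu> (u + real i * ((v - u) / real (Suc n))))) - I) < r"
  proof (intro exI allI impI)
    fix n assume "n \<ge> N"
    define h where "h = (v - u) / real (Suc n)"
    have h: "h > 0" "h < \<delta>" "u + real (Suc n) * h = v"
      using N[OF \<open>n \<ge> N\<close>] assms(2) by (auto simp: h_def)
    have \<tau>': "\<tau> n i \<in> {u + real i * h..u + real (Suc i) * h}" for i
      using \<tau>[of n i] unfolding h_def .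
    let ?g = "\<lambda>i. (\<tau> n i, {u + real i * h..u + real (Suc i) * h})"
    \<comment> \<open>A tagged division is a set of pairs; without injectivity the sum over it could
      not be rewritten as a sum over indices.\<close>
    have inj: "inj_on ?g {..<Suc n}"
    proof (rule inj_onI)
      fix i j assume "?g i = ?g j"
      then have "u + real i * h = u + real j * h"
        using h(1) by (simp add: Icc_eq_Icc algebra_simps)
      then show "i = j" using h(1) by simp
    qed
    have div: "?g ` {..<Suc n} tagged_division_of {u..v}"
      using uniform_tagged_division[OF h(1) _ \<tau>', of "Suc n"] h(3) by simp
    have fine: "(\<lambda>x. ball x \<delta>) fine (?g ` {..<Suc n})"
      unfolding fine_def
    proof (clarify, simp only: mem_ball)
      fix i y assume "y \<in> {u + real i * h..u + real (Suc i) * h}"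
      then show "dist (\<tau> n i) y < \<delta>"
        using \<tau>'[of i] h(2) by (simp add: dist_real_def algebra_simps abs_less_iff)
    qed
    have "(\<Sum>(x, k)\<in>?g ` {..<Suc n}. e x * (\<mu> (Sup k) - \<mu> (Inf k))) =
       (\<Sum>i<Suc n. e (\<tau> n i) * (\<mu> (u + real (Suc i) * h) - \<mu> (u + real i * h)))"
      using h(1) by (subst sum.reindex[OF inj]) (simp add: algebra_simps)
    then show "norm ((\<Sum>i<Suc n. e (\<tau> n i) * (\<mu> (u + real (Suc i) * ((v - u) / real (Suc n))) -
            \<mu> (u + real i * ((v - u) / real (Suc n))))) - I) < r"
      using \<delta>[OF div fine] unfolding h_def by (simp only:)
  qed
qed

text \<open>Inside a cell the grid average is the constant mean of the two end values, so the
  trapezoidal sum is an exact integral and no error term arises.\<close>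

lemma grid_average_has_integral:
  fixes e e' :: "real \<Rightarrow> complex"
  assumes "\<And>t. (e has_vector_derivative e' t) (at t)" "h > 0"
  shows "((\<lambda>t. grid_average \<mu> u h t * e' t) has_integral
     (\<Sum>i<n. (\<mu> (u + real i * h) + \<mu> (u + real (Suc i) * h)) / 2 *
        (e (u + real (Suc i) * h) - e (u + real i * h)))) {u..u + real n * h}"
proof (induction n)
  case 0
  then show ?case using has_integral_refl(2)[of _ u] by simp
next
  case (Suc n)
  let ?a = "u + real n * h" and ?b = "u + real (Suc n) * h"
  have ab: "?a \<le> ?b" using assms(2) by (simp add: algebra_simps)
  have "((\<lambda>t. (\<mu> ?a + \<mu> ?b) / 2 * e' t) has_integral (\<mu> ?a + \<mu> ?b) / 2 * (e ?b - e ?a)) {?a..?b}"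
    by (rule has_integral_mult_right[OF fundamental_theorem_of_calculus[OF ab
            has_vector_derivative_at_within[OF assms(1)]]])
  then have "((\<lambda>t. grid_average \<mu> u h t * e' t) has_integral (\<mu> ?a + \<mu> ?b) / 2 * (e ?b - e ?a)) {?a..?b}"
  \<comment> \<open>At an end point of the cell the two grid neighbours straddle that point, so the
    average takes another value there; finitely many points do not affect the integral.\<close>
  proof (rule has_integral_spike_finite[rotated 2])
    show "finite {?a, ?b}" by simp
    fix t assume t: "t \<in> {?a..?b} - {?a, ?b}"
    have "real n < (t - u) / h" "(t - u) / h < real n + 1"
      using t assms(2) by (auto simp: field_simps)
    then have "\<lceil>(t - u) / h\<rceil> = int n + 1" "\<lfloor>(t - u) / h\<rfloor> = int n"
      by linarith+
    then show "grid_average \<mu> u h t * e' t = (\<mu> ?a + \<mu> ?b) / 2 * e' t"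
      by (simp add: grid_average_def grid_left_def grid_right_def algebra_simps)
  qed
  from has_integral_combine[OF _ ab Suc.IH this] show ?case
    using assms(2) by simp
qed

text \<open>Summation by parts on a uniform grid, then the mesh tends to 0: the Stieltjes sums
  converge by definition, the trapezoidal sums by dominated convergence of the grid
  averages.\<close>

lemma stieltjes_by_parts:
  fixes e e' :: "real \<Rightarrow> complex"
  assumes \<mu>: "midpoint_regular \<mu>" "\<And>a b. bounded (\<mu> ` {a..b})"
    and e: "\<And>t. (e has_vector_derivative e' t) (at t)" "continuous_on UNIV e'"
    and I: "has_stieltjes_integral e \<mu> u v I" "u < v"
  shows "((\<lambda>t. \<mu> t * e' t) has_integral (e v * \<mu> v - e u * \<mu> u - I)) {u..v}"
proof -
  define h where "h n = (v - u) / real (Suc n)" for n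
  have h: "h n > 0" "h n \<le> v - u" "u + real (Suc n) * h n = v" for n
    using I(2) mult_right_mono[of u v "real n"] by (auto simp: h_def field_simps)
  have h0: "h \<longlonglongrightarrow> 0"
    unfolding h_def
    by (rule real_tendsto_divide_at_top[OF tendsto_const])
       (intro filterlim_compose[OF filterlim_real_sequentially filterlim_Suc])
  define x where "x n i = u + real i * h n" for n i
  have x: "x n 0 = u" "x n (Suc n) = v" "x n i \<le> x n (Suc i)" for n i
    using h[of n] by (auto simp: x_def algebra_simps)
  let ?L = "\<lambda>n. \<Sum>i<Suc n. e (x n i) * (\<mu> (x n (Suc i)) - \<mu> (x n i))"
  let ?R = "\<lambda>n. \<Sum>i<Suc n. e (x n (Suc i)) * (\<mu> (x n (Suc i)) - \<mu> (x n i))"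
  let ?S = "\<lambda>n. \<Sum>i<Suc n. (\<mu> (x n i) + \<mu> (x n (Suc i))) / 2 * (e (x n (Suc i)) - e (x n i))"
  have "?L \<longlonglongrightarrow> I" "?R \<longlonglongrightarrow> I"
    using stieltjes_uniform_sums[OF I, of x] stieltjes_uniform_sums[OF I, of "\<lambda>n i. x n (Suc i)"] x(3)
    unfolding x_def h_def by simp_all
  then have "(\<lambda>n. e v * \<mu> v - e u * \<mu> u - (?L n + ?R n) / 2) \<longlonglongrightarrow> e v * \<mu> v - e u * \<mu> u - (I + I) / 2"
    by (intro tendsto_intros) auto
  \<comment> \<open>On each cell, mean of e times increment of \<mu> plus mean of \<mu> times
    increment of e is the increment of \<open>e * \<mu>\<close>, and these telescope.\<close>
  moreover have "e v * \<mu> v - e u * \<mu> u - (?L n + ?R n) / 2 = ?S n" for n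
  proof -
    have "(?L n + ?R n) / 2 + ?S n = (\<Sum>i<Suc n. e (x n (Suc i)) * \<mu> (x n (Suc i)) - e (x n i) * \<mu> (x n i))"
      unfolding add_divide_distrib sum_divide_distrib sum.distrib[symmetric]
      by (intro sum.cong refl) (simp add: field_simps)
    also have "\<dots> = e v * \<mu> v - e u * \<mu> u"
      by (subst sum_lessThan_telescope) (simp add: x)
    finally show ?thesis by (simp add: algebra_simps)
  qed
  ultimately have S: "?S \<longlonglongrightarrow> e v * \<mu> v - e u * \<mu> u - I" by simp
  have int: "((\<lambda>t. grid_average \<mu> u (h n) t * e' t) has_integral ?S n) {u..v}" for n
    using grid_average_has_integral[OF e(1) h(1), of \<mu> u n "Suc n"] h(3)[of n]
    unfolding x_def by simp
  \<comment> \<open>Grid neighbours of a point of \<open>{u..v}\<close> can lie outside by up to one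
    mesh width, which is at most \<open>v - u\<close>; hence the enlarged interval.\<close>
  obtain C where C: "\<And>t. t \<in> {u - (v - u)..v + (v - u)} \<Longrightarrow> norm (\<mu> t) \<le> C"
    using \<mu>(2)[of "u - (v - u)" "v + (v - u)"] unfolding bounded_iff by blast
  obtain D where D: "\<And>t. t \<in> {u..v} \<Longrightarrow> norm (e' t) \<le> D"
    using compact_imp_bounded[OF compact_continuous_image[OF continuous_on_subset[OF e(2)] compact_Icc], of u v]
    unfolding bounded_iff by blast
  have bound: "norm (grid_average \<mu> u (h n) t * e' t) \<le> C * D" if t: "t \<in> {u..v}" for n t
  proof -
    have "norm (\<mu> (grid_left u (h n) t)) \<le> C"
      using t h(2)[of n] grid_left_bounds[OF h(1)[of n], where t = t and u = u] I(2) by (intro C) auto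
    moreover have "norm (\<mu> (grid_right u (h n) t)) \<le> C"
      using t h(2)[of n] grid_right_bounds[OF h(1)[of n], where t = t and u = u] I(2) by (intro C) auto
    ultimately have "norm (grid_average \<mu> u (h n) t) \<le> C"
      unfolding grid_average_def norm_divide
      by (intro order_trans[OF divide_right_mono[OF norm_triangle_ineq]]) auto
    then show ?thesis
      unfolding norm_mult using D[OF t] by (intro mult_mono') simp_all
  qed
  have lim: "(\<lambda>n. grid_average \<mu> u (h n) t * e' t) \<longlonglongrightarrow> \<mu> t * e' t" for t
    by (intro tendsto_intros grid_average_tendsto[OF \<mu>(1) h(1) h0])
  have *: "(\<lambda>t. grid_average \<mu> u (h n) t * e' t) integrable_on {u..v}" for n
    using int by blast
  have "(\<lambda>t. \<mu> t * e' t) integrable_on {u..v}"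
    "(\<lambda>n. integral {u..v} (\<lambda>t. grid_average \<mu> u (h n) t * e' t)) \<longlonglongrightarrow> integral {u..v} (\<lambda>t. \<mu> t * e' t)"
    using dominated_convergence[where f = "\<lambda>n t. grid_average \<mu> u (h n) t * e' t", OF * _ bound lim]
    by auto
  then show ?thesis
    using S integral_unique[OF int] LIMSEQ_unique by (auto simp: has_integral_iff)
qed

section \<open>Growth of determining functions\<close>

lemma has_integral_id_mult_exp:
  fixes c v w :: real
  assumes "c \<noteq> 0" "v \<le> w"
  shows "((\<lambda>t. t * exp (c * t)) has_integral
     exp (c * w) * (w / c - 1 / c\<^sup>2) - exp (c * v) * (v / c - 1 / c\<^sup>2)) {v..w}"
proof (rule fundamental_theorem_of_calculus[OF assms(2)])
  fix t
  show "((\<lambda>t. exp (c * t) * (t / c - 1 / c\<^sup>2)) has_vector_derivative t * exp (c * t)) (at t within {v..w})"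
    unfolding has_real_derivative_iff_has_vector_derivative[symmetric]
    using assms(1)
    by (auto intro!: derivative_eq_intros simp: field_simps power2_eq_square)
qed

text \<open>In terms of the primitives A of \<open>\<alpha>\<close> and \<open>\<Psi>\<close> of \<open>\<phi>\<close> the defining relation of \<open>\<alpha>\<close> becomes
  \<open>\<Psi>' = A - c \<Psi>\<close>, with continuous A. The corresponding equation for \<open>\<phi>\<close> itself would only hold
  almost everywhere; passing to primitives costs the factor \<open>1 + v\<close>.\<close>

lemma halfline_growth:
  fixes \<mu> :: "real \<Rightarrow> complex" and c :: real
  defines "\<phi> \<equiv> \<lambda>v. integral {0..v} (\<lambda>t. of_real (exp (- c * t)) * \<mu> t)"
  assumes c: "c \<noteq> 0"
    and int: "\<And>v. (\<lambda>t. of_real (exp (- c * t)) * \<mu> t) integrable_on {0..v}"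
    and R: "\<And>v. v \<ge> 0 \<Longrightarrow> norm (of_real (exp (- c * v)) * \<mu> v + of_real c * \<phi> v) \<le> R"
  shows "\<exists>m C. (c > 0 \<longrightarrow> m = 0) \<and> (\<forall>v\<ge>0. norm (\<mu> v - m) \<le> C * ((1 + v) * exp (c * v)))"
proof -
  define \<alpha> where "\<alpha> v = of_real (exp (- c * v)) * \<mu> v + of_real c * \<phi> v" for v
  define A where "A v = integral {0..v} \<alpha>" for v
  define \<Psi> where "\<Psi> v = integral {0..v} \<phi>" for v
  define E :: "real \<Rightarrow> complex" where "E t = of_real (exp (c * t))" for t
  define B where "B v = E v * \<Psi> v" for v
  define Q where "Q t = exp (c * t) * (t / c - 1 / c\<^sup>2)" for t
  have \<phi>_cont: "continuous_on {0..v} \<phi>" for v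
    unfolding \<phi>_def by (rule indefinite_integral_continuous_1[OF int])
  have \<alpha>_int: "\<alpha> integrable_on {0..v}" for v
    unfolding \<alpha>_def
    by (intro integrable_add int integrable_on_mult_right integrable_continuous_interval \<phi>_cont)
  have A_cont: "continuous_on {0..v} A" for v
    unfolding A_def by (rule indefinite_integral_continuous_1[OF \<alpha>_int])
  have \<phi>_eq: "\<phi> v = A v - of_real c * \<Psi> v" for v
  proof -
    have "\<phi> v = integral {0..v} (\<lambda>t. \<alpha> t - of_real c * \<phi> t)"
      unfolding \<alpha>_def by (simp add: \<phi>_def)
    also have "\<dots> = A v - of_real c * \<Psi> v"
      unfolding A_def \<Psi>_def
      by (subst integral_diff) (auto intro: \<alpha>_int integrable_on_mult_right integrable_continuous_interval \<phi>_cont)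
    finally show ?thesis .
  qed
  have A_bound: "norm (A t) \<le> R * t" if "t \<ge> 0" for t
  proof -
    have "norm (A t) \<le> integral {0..t} (\<lambda>_. R)"
      unfolding A_def using R by (intro integral_norm_bound_integral \<alpha>_int) (auto simp: \<alpha>_def)
    then show ?thesis using that by (simp add: mult.commute)
  qed
  \<comment> \<open>Solving the definition of \<alpha> for \<mu> and inserting
    \<open>\<phi>_eq\<close> isolates a term of the desired size (\<open>first\<close>) and leaves
    only a multiple of \<open>B\<close> to be estimated.\<close>
  have \<mu>_eq: "\<mu> v = E v * (\<alpha> v - of_real c * A v) + (of_real c)\<^sup>2 * B v" for v
  proof -
    have "E v * of_real (exp (- c * v)) = 1"
      unfolding E_def of_real_mult[symmetric] by (simp flip: exp_add)
    then have "\<mu> v = E v * (of_real (exp (- c * v)) * \<mu> v)" by (simp flip: mult.assoc)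
    also have "\<dots> = E v * (\<alpha> v - of_real c * \<phi> v)" by (simp add: \<alpha>_def)
    also have "\<dots> = E v * (\<alpha> v - of_real c * A v) + (of_real c)\<^sup>2 * B v"
      unfolding \<phi>_eq B_def by (simp add: algebra_simps power2_eq_square)
    finally show ?thesis .
  qed
  \<comment> \<open>\<open>E\<close> is the integrating factor of
    \<open>\<Psi>' = A - c \<Psi>\<close>, so \<open>B' = E A\<close>. With \<open>A_bound\<close>
    the increment is at most R times an integral of \<open>t * exp (c * t)\<close>, whose primitive
    is \<open>Q\<close>.\<close>
  have B_diff: "norm (B w - B v) \<le> R * (Q w - Q v)" if "0 \<le> v" "v \<le> w" for v w
  proof -
    have der: "(B has_vector_derivative E t * A t) (at t within {v..w})" if "t \<in> {v..w}" for t
    proof -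
      have t: "t \<in> {0..w}" using that \<open>0 \<le> v\<close> by auto
      have "(\<Psi> has_vector_derivative \<phi> t) (at t within {0..w})"
        unfolding \<Psi>_def by (rule integral_has_vector_derivative[OF \<phi>_cont t])
      then have "(\<Psi> has_vector_derivative \<phi> t) (at t within {v..w})"
        by (rule has_vector_derivative_within_subset) (use \<open>0 \<le> v\<close> in auto)
      moreover have "(E has_vector_derivative of_real (c * exp (c * t))) (at t within {v..w})"
        unfolding E_def
        by (rule has_vector_derivative_of_real)
           (auto intro!: derivative_eq_intros simp flip: has_real_derivative_iff_has_vector_derivative)
      ultimately have "(B has_vector_derivative E t * \<phi> t + of_real (c * exp (c * t)) * \<Psi> t) (at t within {v..w})"
        unfolding B_def by (intro has_vector_derivative_mult)
      then show ?thesis unfolding \<phi>_eq by (simp add: E_def algebra_simps)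
    qed
    have ftc: "((\<lambda>t. E t * A t) has_integral (B w - B v)) {v..w}"
      by (rule fundamental_theorem_of_calculus[OF that(2) der])
    have "((\<lambda>t. R * (t * exp (c * t))) has_integral R * (Q w - Q v)) {v..w}"
      unfolding Q_def by (intro has_integral_mult_right has_integral_id_mult_exp c that)
    moreover have "norm (E t * A t) \<le> R * (t * exp (c * t))" if "t \<in> {v..w}" for t
      using A_bound[of t] that \<open>0 \<le> v\<close> mult_right_mono[of "norm (A t)" "R * t" "exp (c * t)"]
      by (auto simp: E_def norm_mult mult_ac)
    ultimately show ?thesis
      using ftc integral_norm_bound_integral[of "\<lambda>t. E t * A t" "{v..w}" "\<lambda>t. R * (t * exp (c * t))"]
      by (auto simp: has_integral_iff)
  qed
  have R0: "R \<ge> 0" using R[of 0] norm_ge_zero order_trans by blast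
  have first: "norm (E v * (\<alpha> v - of_real c * A v)) \<le> (R + \<bar>c\<bar> * (R * v)) * exp (c * v)" if "v \<ge> 0" for v
  proof -
    have "norm (\<alpha> v - of_real c * A v) \<le> R + \<bar>c\<bar> * (R * v)"
      using R[OF that] A_bound[OF that]
      by (intro order_trans[OF norm_triangle_ineq4] add_mono) (auto simp: \<alpha>_def norm_mult mult_left_mono)
    then show ?thesis by (simp add: E_def norm_mult mult.commute)
  qed
  define C where "C = R + \<bar>c\<bar> * R + c\<^sup>2 * (R * (1 / \<bar>c\<bar> + 1 / c\<^sup>2))"
  have final: "norm (\<mu> v - m) \<le> C * ((1 + v) * exp (c * v))"
    if v: "v \<ge> 0" and m: "norm (of_real (c\<^sup>2) * B v - m) \<le> c\<^sup>2 * (R * (exp (c * v) * (v / \<bar>c\<bar> + 1 / c\<^sup>2)))" for v m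
  proof -
    have "norm (\<mu> v - m) \<le> norm (E v * (\<alpha> v - of_real c * A v)) + norm (of_real (c\<^sup>2) * B v - m)"
      using norm_triangle_ineq[of "E v * (\<alpha> v - of_real c * A v)" "of_real (c\<^sup>2) * B v - m"]
      by (simp add: \<mu>_eq add_diff_eq)
    also have "\<dots> \<le> (R + \<bar>c\<bar> * (R * v)) * exp (c * v) + c\<^sup>2 * (R * (exp (c * v) * (v / \<bar>c\<bar> + 1 / c\<^sup>2)))"
      by (intro add_mono first v m)
    also have "\<dots> = (R * 1 + \<bar>c\<bar> * R * v + c\<^sup>2 * (R * (v / \<bar>c\<bar> + 1 / c\<^sup>2))) * exp (c * v)"
      by (simp add: algebra_simps)
    also have "\<dots> \<le> (R * (1 + v) + \<bar>c\<bar> * R * (1 + v) + c\<^sup>2 * (R * ((1 + v) / \<bar>c\<bar> + (1 + v) / c\<^sup>2))) * exp (c * v)"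
      using R0 v by (intro mult_right_mono add_mono mult_left_mono divide_right_mono) auto
    also have "\<dots> = C * ((1 + v) * exp (c * v))"
      unfolding C_def by (simp add: algebra_simps add_divide_distrib)
    finally show ?thesis .
  qed
  show ?thesis
  proof (cases "c > 0")
    case True
    have "norm (\<mu> v - 0) \<le> C * ((1 + v) * exp (c * v))" if v: "v \<ge> 0" for v
    proof (rule final[OF v])
      have "norm (B v) \<le> R * (Q v - Q 0)"
        using B_diff[of 0 v] v by (simp add: B_def \<Psi>_def)
      also have "Q v - Q 0 \<le> exp (c * v) * (v / c + 1 / c\<^sup>2)"
      proof -
        have "1 \<le> exp (c * v)" using True v by simp
        then have "1 / c\<^sup>2 \<le> exp (c * v) * (1 / c\<^sup>2)"
          using divide_right_mono[of 1 "exp (c * v)" "c\<^sup>2"] by simp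
        moreover have "0 \<le> exp (c * v) * (1 / c\<^sup>2)" by simp
        moreover have "Q 0 = - (1 / c\<^sup>2)" by (simp add: Q_def)
        ultimately show ?thesis unfolding Q_def right_diff_distrib distrib_left by linarith
      qed
      finally have "norm (B v) \<le> R * (exp (c * v) * (v / \<bar>c\<bar> + 1 / c\<^sup>2))"
        using True R0 by (simp add: mult_left_mono)
      then show "norm (of_real (c\<^sup>2) * B v - 0) \<le> c\<^sup>2 * (R * (exp (c * v) * (v / \<bar>c\<bar> + 1 / c\<^sup>2)))"
        by (simp add: norm_mult norm_power mult_left_mono)
    qed
    then show ?thesis by blast
  next
    case False
    then have c0: "c < 0" using c by simp
    have Q_neg: "Q v = - (exp (c * v) * (v / \<bar>c\<bar> + 1 / c\<^sup>2))" for v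
      using c0 by (simp add: Q_def algebra_simps)
    have Bb: "norm (B w - B v) \<le> - R * Q v" if "0 \<le> v" "v \<le> w" for v w
    proof -
      have "Q w \<le> 0" unfolding Q_neg using that by simp
      then have "R * (Q w - Q v) \<le> R * (0 - Q v)" using R0 by (intro mult_left_mono) auto
      then show ?thesis using B_diff[OF that] by simp
    qed
    have Q_lim: "((\<lambda>v. - R * Q v) \<longlongrightarrow> 0) at_top"
      unfolding Q_def using c0 by real_asymp
    have Q_seq: "(\<lambda>n. - R * Q (real n)) \<longlonglongrightarrow> 0"
      using filterlim_compose[OF Q_lim filterlim_real_sequentially] .
    \<comment> \<open>For c < 0 the function \<open>B\<close> need not tend to 0, but by
      \<open>Bb\<close> its oscillation beyond v is at most the decaying \<open>- R * Q v\<close>.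
      So it has a limit b along the integers, and \<open>c\<^sup>2 * b\<close> is the limit m of
      \<mu>.\<close>
    have "Cauchy (\<lambda>n. B (real n))"
    proof (rule CauchyI')
      fix e :: real assume "e > 0"
      from order_tendstoD(2)[OF Q_seq this] obtain N where N: "\<And>n. n \<ge> N \<Longrightarrow> - R * Q (real n) < e"
        unfolding eventually_sequentially by meson
      have "dist (B (real n)) (B (real i)) < e" if "n \<ge> N" "i > n" for i n
        using Bb[of "real n" "real i"] N[OF that(1)] that
        by (simp add: dist_norm norm_minus_commute)
      then show "\<exists>M. \<forall>m\<ge>M. \<forall>n>m. dist (B (real m)) (B (real n)) < e"
        by blast
    qed
    then obtain b where b: "(\<lambda>n. B (real n)) \<longlonglongrightarrow> b"
      using Cauchy_convergent convergent_def by blast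
    have "norm (b - B v) \<le> - R * Q v" if "v \<ge> 0" for v
    proof (rule tendsto_upperbound)
      show "(\<lambda>n. norm (B (real n) - B v)) \<longlonglongrightarrow> norm (b - B v)"
        by (intro tendsto_intros b)
      have "eventually (\<lambda>n. v \<le> real n) sequentially"
        using filterlim_real_sequentially by (simp add: filterlim_at_top)
      then show "eventually (\<lambda>n. norm (B (real n) - B v) \<le> - R * Q v) sequentially"
        by eventually_elim (use Bb that in auto)
    qed simp
    then have "norm (of_real (c\<^sup>2) * B v - of_real (c\<^sup>2) * b) \<le> c\<^sup>2 * (R * (exp (c * v) * (v / \<bar>c\<bar> + 1 / c\<^sup>2)))"
      if "v \<ge> 0" for v
      using that unfolding right_diff_distrib[symmetric] norm_mult
      by (simp add: Q_neg norm_minus_commute norm_power mult_left_mono)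
    from final[OF _ this] c0 show ?thesis by (intro exI[of _ "of_real (c\<^sup>2) * b"] exI[of _ C]) auto
  qed
qed

text \<open>Convergence bounds the expression only beyond some V; on \<open>{0..V}\<close> the
  boundedness of \<mu> and the continuity of the indefinite integral provide the bound.\<close>

lemma halfline_growth_of_limit:
  fixes \<mu> :: "real \<Rightarrow> complex" and c :: real
  assumes c: "c \<noteq> 0"
    and int: "\<And>v. (\<lambda>t. of_real (exp (- c * t)) * \<mu> t) integrable_on {0..v}"
    and bdd: "\<And>v. bounded (\<mu> ` {0..v})"
    and lim: "((\<lambda>v. of_real (exp (- c * v)) * \<mu> v +
        of_real c * integral {0..v} (\<lambda>t. of_real (exp (- c * t)) * \<mu> t)) \<longlongrightarrow> r) at_top"
  shows "\<exists>m C. (c > 0 \<longrightarrow> m = 0) \<and> (\<forall>v\<ge>0. norm (\<mu> v - m) \<le> C * ((1 + v) * exp (c * v)))"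
proof -
  define \<phi> where "\<phi> v = integral {0..v} (\<lambda>t. of_real (exp (- c * t)) * \<mu> t)" for v
  define \<alpha> where "\<alpha> v = of_real (exp (- c * v)) * \<mu> v + of_real c * \<phi> v" for v
  have "(\<alpha> \<longlongrightarrow> r) at_top" unfolding \<alpha>_def \<phi>_def by (rule lim)
  then have "eventually (\<lambda>v. norm (\<alpha> v) < norm r + 1) at_top"
    by (intro order_tendstoD(2)[OF tendsto_norm]) auto
  then obtain V where V: "\<And>v. v \<ge> V \<Longrightarrow> norm (\<alpha> v) < norm r + 1"
    unfolding eventually_at_top_linorder by blast
  obtain M where M: "\<And>t. t \<in> {0..V} \<Longrightarrow> norm (\<mu> t) \<le> M"
    using bdd[of V] unfolding bounded_iff by blast
  have "continuous_on {0..V} \<phi>"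
    unfolding \<phi>_def by (rule indefinite_integral_continuous_1[OF int])
  from compact_imp_bounded[OF compact_continuous_image[OF this compact_Icc]]
  obtain P where P: "\<And>t. t \<in> {0..V} \<Longrightarrow> norm (\<phi> t) \<le> P"
    unfolding bounded_iff by blast
  have "continuous_on {0..V} (\<lambda>v. exp (- c * v))" by (intro continuous_intros)
  from compact_imp_bounded[OF compact_continuous_image[OF this compact_Icc]]
  obtain K where K: "\<And>t. t \<in> {0..V} \<Longrightarrow> norm (exp (- c * t)) \<le> K"
    unfolding bounded_iff by blast
  have "norm (\<alpha> v) \<le> max (norm r + 1) (K * M + \<bar>c\<bar> * P)" if "v \<ge> 0" for v
  proof (cases "v \<ge> V")
    case True
    then show ?thesis using V[OF True] by linarith
  next
    case False
    then have v: "v \<in> {0..V}" using that by auto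
    have "norm (\<alpha> v) \<le> norm (exp (- c * v)) * norm (\<mu> v) + \<bar>c\<bar> * norm (\<phi> v)"
      unfolding \<alpha>_def by (rule order_trans[OF norm_triangle_ineq]) (simp add: norm_mult)
    also have "\<dots> \<le> K * M + \<bar>c\<bar> * P"
      using M[OF v] K[OF v] P[OF v] by (intro add_mono mult_mono' mult_left_mono) simp_all
    finally show ?thesis by linarith
  qed
  then show ?thesis
    unfolding \<alpha>_def \<phi>_def by (rule halfline_growth[OF c int])
qed

section \<open>From half-lines to the bilateral transform\<close>

lemma exp_mult_has_vector_derivative:
  "((\<lambda>t. exp (- s * of_real t)) has_vector_derivative (- s * exp (- s * of_real t))) (at t)"
  for s :: complex
  by (rule has_vector_derivative_real_field[where f = "\<lambda>z. exp (- s * z)"])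
     (auto intro!: derivative_eq_intros)

lemma determining_function_midpoint_regular:
  assumes "determining_function \<mu>"
  shows "midpoint_regular \<mu>"
  using assms by (simp add: determining_function_def normalized_def midpoint_regular_def)

lemma determining_function_bounded:
  assumes "determining_function \<mu>"
  shows "bounded (\<mu> ` {u..v})"
  using assms by (auto simp: determining_function_def intro: bounded_variation_on_imp_bounded)

text \<open>The constant m is free because Stieltjes sums see only increments of \<mu>. The
  alternative \<open>I = 0\<close> covers the one-point interval, to which
  \<open>stieltjes_by_parts\<close> does not apply.\<close>

lemma laplace_stieltjes_by_parts:
  assumes \<mu>: "determining_function \<mu>" and "u \<le> v" "u < v \<or> I = 0"
    and I: "has_stieltjes_integral (\<lambda>t. exp (- s * of_real t)) \<mu> u v I"
  shows "((\<lambda>t. s * (exp (- s * of_real t) * (\<mu> t - m))) has_integral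
     (I + exp (- s * of_real u) * (\<mu> u - m) - exp (- s * of_real v) * (\<mu> v - m))) {u..v}"
proof (cases "u < v")
  case True
  have *: "((\<lambda>t. (\<mu> t - m) * (- s * exp (- s * of_real t))) has_integral
     (exp (- s * of_real v) * (\<mu> v - m) - exp (- s * of_real u) * (\<mu> u - m) - I)) {u..v}"
  proof (rule stieltjes_by_parts[OF _ _ exp_mult_has_vector_derivative])
    show "midpoint_regular (\<lambda>t. \<mu> t - m)"
      by (intro midpoint_regular_diff_const determining_function_midpoint_regular \<mu>)
    show "bounded ((\<lambda>t. \<mu> t - m) ` {a..b})" for a b
      by (intro bounded_minus_comp determining_function_bounded[OF \<mu>])
         (auto simp: image_constant_conv)
    show "continuous_on UNIV (\<lambda>t. - s * exp (- s * complex_of_real t))"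
      by (intro continuous_intros)
    show "has_stieltjes_integral (\<lambda>t. exp (- s * of_real t)) (\<lambda>t. \<mu> t - m) u v I"
      using I by (simp add: has_stieltjes_integral_def)
  qed (fact True)
  show ?thesis using has_integral_neg[OF *] by (simp add: mult_ac diff_diff_eq2)
next
  case False
  then show ?thesis using assms(2,3) has_integral_refl(2)[of _ v] by auto
qed

text \<open>With uniqueness this fixes the partial integrals at 0, \<open>G 0\<close> and
  \<open>H 0\<close>, to be 0.\<close>

lemma has_stieltjes_integral_refl: "has_stieltjes_integral f \<mu> u u 0"
  unfolding has_stieltjes_integral_def
proof (intro allI impI exI[of _ 1] conjI)
  fix \<epsilon> :: real and p assume "\<epsilon> > 0" and p: "p tagged_division_of {u..u} \<and> (\<lambda>x. ball x 1) fine p"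
  have "f x * (\<mu> (Sup k) - \<mu> (Inf k)) = 0" if "(x, k) \<in> p" for x k
  proof -
    have "x \<in> k" "k \<subseteq> {u}"
      using p that tagged_division_ofD(2,3)[of p "{u..u}" x k] by auto
    then have "k = {u}" by auto
    then show ?thesis by simp
  qed
  then have "(\<Sum>(x, k)\<in>p. f x * (\<mu> (Sup k) - \<mu> (Inf k))) = 0"
    by (intro sum.neutral) auto
  then show "norm ((\<Sum>(x, k)\<in>p. f x * (\<mu> (Sup k) - \<mu> (Inf k))) - 0) < \<epsilon>"
    using \<open>\<epsilon> > 0\<close> by simp
qed simp

text \<open>On the half-line where \<open>exp (c t)\<close> decays, m is the limit of \<open>\<mu>\<close>; on the other one any constant
  is absorbed by \<open>exp (c t)\<close>.\<close>

lemma laplace_stieltjes_growth: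
  fixes c :: real
  assumes \<mu>: "determining_function \<mu>" and c: "c \<noteq> 0"
    and L: "has_laplace_stieltjes \<mu> (of_real c) L"
  shows "\<exists>m C. \<forall>t. norm (\<mu> t - m) \<le> C * ((1 + \<bar>t\<bar>) * exp (c * t))"
proof -
  obtain G H l r where
    G: "\<And>v. v \<ge> 0 \<Longrightarrow> has_stieltjes_integral (\<lambda>t. exp (- of_real c * of_real t)) \<mu> 0 v (G v)" and
    H: "\<And>u. u \<le> 0 \<Longrightarrow> has_stieltjes_integral (\<lambda>t. exp (- of_real c * of_real t)) \<mu> u 0 (H u)" and
    lim: "(G \<longlongrightarrow> r) at_top" "(H \<longlongrightarrow> l) at_bot"
    using L unfolding has_laplace_stieltjes_def by blast
  have G0: "G 0 = 0" and H0: "H 0 = 0"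
    using G[of 0] H[of 0] has_stieltjes_integral_refl has_stieltjes_integral_unique by blast+
  have \<mu>0: "\<mu> 0 = 0" using \<mu> by (simp add: determining_function_def normalized_def)
  have e: "exp (- (complex_of_real c * of_real t)) = of_real (exp (- (c * t)))" for t
    unfolding exp_of_real[symmetric] by simp
  have hiG: "((\<lambda>t. of_real (exp (- c * t)) * \<mu> t) has_integral
      (G v - of_real (exp (- c * v)) * \<mu> v) / of_real c) {0..v}" if "v \<ge> 0" for v
    using has_integral_divide[OF laplace_stieltjes_by_parts[OF \<mu> that _ G[OF that], of 0], of "of_real c"] that G0 c
    by (cases "v = 0") (simp_all add: e \<mu>0 del: of_real_exp)
  have hiH: "((\<lambda>t. of_real (exp (- c * t)) * \<mu> t) has_integral
      (H u + of_real (exp (- c * u)) * \<mu> u) / of_real c) {u..0}" if "u \<le> 0" for u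
    using has_integral_divide[OF laplace_stieltjes_by_parts[OF \<mu> that _ H[OF that], of 0], of "of_real c"] that H0 c
    by (cases "u = 0") (simp_all add: e \<mu>0 del: of_real_exp)
  have hiH': "((\<lambda>t. of_real (exp (- (- c) * t)) * \<mu> (- t)) has_integral
      (H (- v) + of_real (exp (c * v)) * \<mu> (- v)) / of_real c) {0..v}" if "v \<ge> 0" for v
    using hiH[of "- v"] that
      has_integral_reflect_real[of "\<lambda>t. of_real (exp (- c * t)) * \<mu> t" _ 0 "- v"] by simp
  have triv: "f integrable_on {0..v}" if "\<not> v \<ge> 0" for f :: "real \<Rightarrow> complex" and v
    using that by (simp add: integrable_on_empty)
  have "\<exists>m C. (c > 0 \<longrightarrow> m = 0) \<and> (\<forall>v\<ge>0. norm (\<mu> v - m) \<le> C * ((1 + v) * exp (c * v)))"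
  proof (rule halfline_growth_of_limit[OF c])
    show "(\<lambda>t. of_real (exp (- c * t)) * \<mu> t) integrable_on {0..v}" for v
      using hiG[of v] triv by blast
    show "bounded (\<mu> ` {0..v})" for v by (rule determining_function_bounded[OF \<mu>])
    show "((\<lambda>v. of_real (exp (- c * v)) * \<mu> v +
        of_real c * integral {0..v} (\<lambda>t. of_real (exp (- c * t)) * \<mu> t)) \<longlongrightarrow> r) at_top"
    proof (rule Lim_transform_eventually[OF lim(1)])
      show "eventually (\<lambda>v. G v = of_real (exp (- c * v)) * \<mu> v +
        of_real c * integral {0..v} (\<lambda>t. of_real (exp (- c * t)) * \<mu> t)) at_top"
        using eventually_ge_at_top[of 0]
        by eventually_elim (use c in \<open>simp only: integral_unique[OF hiG], simp del: of_real_exp\<close>)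
    qed
  qed
  then obtain m1 C1 where 1: "c > 0 \<longrightarrow> m1 = 0"
    "\<And>v. v \<ge> 0 \<Longrightarrow> norm (\<mu> v - m1) \<le> C1 * ((1 + v) * exp (c * v))" by blast
  \<comment> \<open>The left half-line is the right one for the reflected function with exponent -c.
    The boundary term cancels and what remains is \<open>- H (- v)\<close>, hence the limit
    \<open>- l\<close>.\<close>
  have "\<exists>m C. (- c > 0 \<longrightarrow> m = 0) \<and> (\<forall>v\<ge>0. norm (\<mu> (- v) - m) \<le> C * ((1 + v) * exp (- c * v)))"
  proof (rule halfline_growth_of_limit)
    show "(\<lambda>t. of_real (exp (- (- c) * t)) * \<mu> (- t)) integrable_on {0..v}" for v
      using hiH'[of v] triv by blast
    have "(\<lambda>t. \<mu> (- t)) ` {0..v} = \<mu> ` {- v..0}" for v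
      by (force simp: image_iff intro: bexI[of _ "- _"])
    then show "bounded ((\<lambda>t. \<mu> (- t)) ` {0..v})" for v
      by (simp add: determining_function_bounded[OF \<mu>])
    show "((\<lambda>v. of_real (exp (- (- c) * v)) * \<mu> (- v) +
        of_real (- c) * integral {0..v} (\<lambda>t. of_real (exp (- (- c) * t)) * \<mu> (- t))) \<longlongrightarrow> - l) at_top"
    proof (rule Lim_transform_eventually)
      show "((\<lambda>v. - H (- v)) \<longlongrightarrow> - l) at_top"
        by (intro tendsto_minus filterlim_compose[OF lim(2)] filterlim_uminus_at_bot_at_top)
      show "eventually (\<lambda>v. - H (- v) = of_real (exp (- (- c) * v)) * \<mu> (- v) +
        of_real (- c) * integral {0..v} (\<lambda>t. of_real (exp (- (- c) * t)) * \<mu> (- t))) at_top"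
        using eventually_ge_at_top[of 0]
        by eventually_elim (use c in \<open>simp only: integral_unique[OF hiH'], simp del: of_real_exp\<close>)
    qed
  qed (use c in simp)
  then obtain m2 C2 where 2: "c < 0 \<longrightarrow> m2 = 0"
    "\<And>v. v \<ge> 0 \<Longrightarrow> norm (\<mu> (- v) - m2) \<le> C2 * ((1 + v) * exp (- c * v))" by auto
  \<comment> \<open>The sign of c forces one of the summands to be 0, so the sum selects the limit
    on the decaying side without a case distinction.\<close>
  define m where "m = m1 + m2"
  have shift: "norm (x - m) \<le> (C + norm m) * ((1 + v) * exp (a * v))"
    if "v \<ge> 0" "norm (x - m') \<le> C * ((1 + v) * exp (a * v))" "m' = m \<or> a > 0 \<and> m' = 0" for x m' C v a
  proof (cases "m' = m")
    case True
    have "0 \<le> norm m * ((1 + v) * exp (a * v))" using that(1) by simp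
    then show ?thesis using that(2) True by (simp add: distrib_right)
  next
    case False
    then have a: "a > 0" "m' = 0" using that(3) by auto
    have "1 * 1 \<le> (1 + v) * exp (a * v)" using that(1) a(1) by (intro mult_mono) auto
    from mult_left_mono[OF this, of "norm m"] have "norm m \<le> norm m * ((1 + v) * exp (a * v))" by simp
    then show ?thesis using that(2) a(2) norm_triangle_ineq4[of x m] by (simp add: distrib_right)
  qed
  have "norm (\<mu> t - m) \<le> max (C1 + norm m) (C2 + norm m) * ((1 + \<bar>t\<bar>) * exp (c * t))" for t
  proof (cases "t \<ge> 0")
    case True
    have "norm (\<mu> t - m) \<le> (C1 + norm m) * ((1 + t) * exp (c * t))"
      by (rule shift[OF True 1(2)[OF True]]) (use 1(1) 2(1) c in \<open>auto simp: m_def\<close>)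
    also have "\<dots> \<le> max (C1 + norm m) (C2 + norm m) * ((1 + t) * exp (c * t))"
      using True by (intro mult_right_mono) auto
    finally show ?thesis using True by simp
  next
    case False
    then have t: "- t \<ge> 0" by simp
    have "norm (\<mu> (- (- t)) - m) \<le> (C2 + norm m) * ((1 + (- t)) * exp (- c * (- t)))"
      by (rule shift[OF t 2(2)[OF t]]) (use 1(1) 2(1) c in \<open>auto simp: m_def\<close>)
    also have "\<dots> \<le> max (C1 + norm m) (C2 + norm m) * ((1 + (- t)) * exp (- c * (- t)))"
      using t by (intro mult_right_mono) auto
    finally show ?thesis using t by simp
  qed
  then show ?thesis by blast
qed

section \<open>Absolutely convergent Laplace integrals\<close>

text \<open>Link between the gauge integrals over \<open>{-T..T}\<close> that integration by parts
  and line integrals produce and the Lebesgue integrals that Fubini requires.\<close>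

lemma integral_symmetric_tendsto:
  fixes h :: "real \<Rightarrow> complex"
  assumes h: "integrable lborel h"
  shows "((\<lambda>T. integral {-T..T} h) \<longlongrightarrow> (\<integral>x. h x \<partial>lborel)) at_top"
proof -
  have "set_integrable lborel {-T..T} h" for T
    unfolding set_integrable_def by (rule integrable_mult_indicator[OF _ h]) simp
  then have "integral {-T..T} h = (\<integral>x. indicator {-T..T} x *\<^sub>R h x \<partial>lborel)" for T
    by (simp add: set_borel_integral_eq_integral(2)[symmetric] set_lebesgue_integral_def)
  moreover have "((\<lambda>T. \<integral>x. indicator {-T..T} x *\<^sub>R h x \<partial>lborel) \<longlongrightarrow> (\<integral>x. h x \<partial>lborel)) at_top"
  proof (rule integral_dominated_convergence_at_top)
    show "h \<in> borel_measurable lborel" "integrable lborel (\<lambda>x. norm (h x))"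
      using h by auto
    show "(\<lambda>x. indicator {-T..T} x *\<^sub>R h x) \<in> borel_measurable lborel" for T :: real
      using h by auto
    show "\<forall>\<^sub>F T in at_top. AE x in lborel. norm (indicator {-T..T} x *\<^sub>R h x) \<le> norm (h x)"
      by (intro always_eventually allI AE_I2) (auto simp: indicator_def)
    show "AE x in lborel. ((\<lambda>T. indicator {-T..T} x *\<^sub>R h x) \<longlongrightarrow> h x) at_top"
    proof (rule AE_I2)
      fix x :: real
      have "eventually (\<lambda>T. \<bar>x\<bar> \<le> T) at_top" by (rule eventually_ge_at_top)
      then have "eventually (\<lambda>T. indicator {-T..T} x *\<^sub>R h x = h x) at_top"
        by eventually_elim (auto simp: indicator_def abs_le_iff)
      then show "((\<lambda>T. indicator {-T..T} x *\<^sub>R h x) \<longlongrightarrow> h x) at_top"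
        by (rule tendsto_eventually)
    qed
  qed
  ultimately show ?thesis by simp
qed

lemma integrable_exp_neg_abs:
  fixes \<kappa> :: real
  assumes "\<kappa> > 0"
  shows "integrable lborel (\<lambda>t. exp (- \<kappa> * \<bar>t\<bar>))"
proof (rule Bochner_Integration.integrable_bound)
  have "set_integrable lborel UNIV (\<lambda>x::real. inverse (1 + x\<^sup>2))"
    using integrable_inverse_1_plus_square by simp
  then show "integrable lborel (\<lambda>x. (1 + 2 / \<kappa>\<^sup>2) * inverse (1 + x\<^sup>2))"
    by (simp add: set_integrable_def)
  have "norm (exp (- \<kappa> * \<bar>t\<bar>)) \<le> norm ((1 + 2 / \<kappa>\<^sup>2) * inverse (1 + t\<^sup>2))" for t
  proof -
    have "0 \<le> \<kappa> * \<bar>t\<bar>" using assms by simp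
    from exp_lower_Taylor_quadratic[OF this] this
    have *: "1 \<le> exp (\<kappa> * \<bar>t\<bar>)" "(\<kappa> * \<bar>t\<bar>)\<^sup>2 / 2 \<le> exp (\<kappa> * \<bar>t\<bar>)"
      using zero_le_power2[of "\<kappa> * \<bar>t\<bar>"] by linarith+
    have "1 + t\<^sup>2 = 1 + 2 / \<kappa>\<^sup>2 * ((\<kappa> * \<bar>t\<bar>)\<^sup>2 / 2)"
      using assms by (simp add: power_mult_distrib)
    also have "\<dots> \<le> exp (\<kappa> * \<bar>t\<bar>) + 2 / \<kappa>\<^sup>2 * exp (\<kappa> * \<bar>t\<bar>)"
      using * by (intro add_mono mult_left_mono) auto
    finally have "1 + t\<^sup>2 \<le> (1 + 2 / \<kappa>\<^sup>2) * exp (\<kappa> * \<bar>t\<bar>)" by (simp add: distrib_right)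
    moreover have "1 + t\<^sup>2 > 0" by (simp add: add_pos_nonneg)
    ultimately have "exp (- (\<kappa> * \<bar>t\<bar>)) \<le> (1 + 2 / \<kappa>\<^sup>2) * inverse (1 + t\<^sup>2)"
      by (simp add: exp_minus field_simps)
    then show ?thesis by simp
  qed
  then show "AE t in lborel. norm (exp (- \<kappa> * \<bar>t\<bar>)) \<le> norm ((1 + 2 / \<kappa>\<^sup>2) * inverse (1 + t\<^sup>2))"
    by (rule AE_I2)
qed measurable

lemma one_plus_le_exp:
  fixes \<kappa> t :: real
  assumes "\<kappa> > 0" "t \<ge> 0"
  shows "1 + t \<le> (1 + 1 / \<kappa>) * exp (\<kappa> * t)"
proof -
  have *: "1 \<le> exp (\<kappa> * t)" "\<kappa> * t \<le> exp (\<kappa> * t)"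
    using assms exp_ge_add_one_self[of "\<kappa> * t"] by (simp, linarith)
  have "1 + t = 1 + 1 / \<kappa> * (\<kappa> * t)" using assms by simp
  also have "\<dots> \<le> exp (\<kappa> * t) + 1 / \<kappa> * exp (\<kappa> * t)"
    using * assms by (intro add_mono mult_left_mono) auto
  finally show ?thesis by (simp add: distrib_right)
qed

lemma one_plus_abs_mult_exp_tendsto_0:
  fixes a :: real
  shows "a < 0 \<Longrightarrow> ((\<lambda>t. (1 + \<bar>t\<bar>) * exp (a * t)) \<longlongrightarrow> 0) at_top"
    and "a > 0 \<Longrightarrow> ((\<lambda>t. (1 + \<bar>t\<bar>) * exp (a * t)) \<longlongrightarrow> 0) at_bot"
  by real_asymp+

text \<open>The bound at p is the better one for t >= 0, that at q for t <= 0. Since p and q have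
  the same sign, both bounds decay at a common end, which forces their constants m and m' to
  agree.\<close>

lemma laplace_stieltjes_two_sided_growth:
  fixes p c q :: real
  assumes \<mu>: "determining_function \<mu>" and pcq: "p < c" "c < q" and sgn: "q < 0 \<or> 0 < p"
    and L: "has_laplace_stieltjes \<mu> (of_real p) Lp" "has_laplace_stieltjes \<mu> (of_real q) Lq"
  shows "\<exists>m C. \<exists>\<kappa>>0. \<forall>t. norm (\<mu> t - m) \<le> C * exp (c * t - \<kappa> * \<bar>t\<bar>)"
proof -
  obtain m C where C: "\<And>t. norm (\<mu> t - m) \<le> C * ((1 + \<bar>t\<bar>) * exp (p * t))"
    using laplace_stieltjes_growth[OF \<mu> _ L(1)] sgn pcq by fastforce
  obtain m' C' where C': "\<And>t. norm (\<mu> t - m') \<le> C' * ((1 + \<bar>t\<bar>) * exp (q * t))"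
    using laplace_stieltjes_growth[OF \<mu> _ L(2)] sgn pcq by fastforce
  define b where "b t = C * ((1 + \<bar>t\<bar>) * exp (p * t)) + C' * ((1 + \<bar>t\<bar>) * exp (q * t))" for t
  have b: "norm (m - m') \<le> b t" for t
    using norm_triangle_ineq4[of "\<mu> t - m'" "\<mu> t - m"] C[of t] C'[of t] by (simp add: b_def)
  have "norm (m - m') \<le> 0"
  proof (cases "q < 0")
    case True
    have "p < 0" using True pcq by simp
    have "(b \<longlongrightarrow> 0) at_top"
      unfolding b_def using True \<open>p < 0\<close>
      by (auto intro!: tendsto_add_zero tendsto_mult_right_zero one_plus_abs_mult_exp_tendsto_0)
    then show ?thesis using b by (intro tendsto_lowerbound) auto
  next
    case False
    have "p > 0" "q > 0" using False pcq sgn by auto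
    then have "(b \<longlongrightarrow> 0) at_bot"
      unfolding b_def by (auto intro!: tendsto_add_zero tendsto_mult_right_zero one_plus_abs_mult_exp_tendsto_0)
    then show ?thesis using b by (intro tendsto_lowerbound) auto
  qed
  then have m': "m' = m" by simp
  \<comment> \<open>Half the smaller gap: one \<kappa> absorbs the factor
    \<open>1 + \<bar>t\<bar>\<close>, the other survives as decay in the conclusion.\<close>
  define \<kappa> where "\<kappa> = min (c - p) (q - c) / 2"
  have \<kappa>: "\<kappa> > 0" "2 * \<kappa> \<le> c - p" "2 * \<kappa> \<le> q - c" using pcq by (auto simp: \<kappa>_def)
  have nonneg: "0 \<le> C" "0 \<le> C'"
    using C[of 0] C'[of 0] order_trans[OF norm_ge_zero] by fastforce+
  have key: "D * ((1 + \<bar>t\<bar>) * exp (a * t)) \<le> D * (1 + 1 / \<kappa>) * exp (c * t - \<kappa> * \<bar>t\<bar>)"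
    if "a * t + 2 * \<kappa> * \<bar>t\<bar> \<le> c * t" "D \<ge> 0" for D a t
  proof -
    have "(1 + \<bar>t\<bar>) * exp (a * t) \<le> (1 + 1 / \<kappa>) * exp (\<kappa> * \<bar>t\<bar>) * exp (a * t)"
      using one_plus_le_exp[OF \<kappa>(1), of "\<bar>t\<bar>"] by (intro mult_right_mono) auto
    also have "\<dots> = (1 + 1 / \<kappa>) * exp (\<kappa> * \<bar>t\<bar> + a * t)" by (simp add: exp_add)
    also have "\<dots> \<le> (1 + 1 / \<kappa>) * exp (c * t - \<kappa> * \<bar>t\<bar>)"
      using that(1) \<kappa>(1) by (intro mult_left_mono) auto
    finally show ?thesis using that(2) by (simp add: mult.assoc mult_left_mono)
  qed
  have "norm (\<mu> t - m) \<le> max (C * (1 + 1 / \<kappa>)) (C' * (1 + 1 / \<kappa>)) * exp (c * t - \<kappa> * \<bar>t\<bar>)" for t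
  proof (cases "t \<ge> 0")
    case True
    have "p * t + 2 * \<kappa> * \<bar>t\<bar> \<le> c * t"
      using True mult_right_mono[OF \<kappa>(2) True] by (simp add: algebra_simps)
    from C[of t] key[OF this nonneg(1)]
    have "norm (\<mu> t - m) \<le> C * (1 + 1 / \<kappa>) * exp (c * t - \<kappa> * \<bar>t\<bar>)" by linarith
    then show ?thesis by (rule order_trans) (intro mult_right_mono, auto)
  next
    case False
    then have t: "- t \<ge> 0" by simp
    have "q * t + 2 * \<kappa> * \<bar>t\<bar> \<le> c * t"
      using t mult_right_mono[OF \<kappa>(3) t] by (simp add: algebra_simps)
    from C'[of t] key[OF this nonneg(2)]
    have "norm (\<mu> t - m) \<le> C' * (1 + 1 / \<kappa>) * exp (c * t - \<kappa> * \<bar>t\<bar>)" unfolding m' by linarith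
    then show ?thesis by (rule order_trans) (intro mult_right_mono, auto)
  qed
  then show ?thesis using \<kappa>(1) by blast
qed

lemma exp_mult_determining_function_integrable:
  fixes \<mu> :: "real \<Rightarrow> complex" and c \<kappa> :: real
  assumes \<mu>: "determining_function \<mu>" and \<kappa>: "\<kappa> > 0"
    and C: "\<And>t. norm (\<mu> t - m) \<le> C * exp (c * t - \<kappa> * \<bar>t\<bar>)" and s: "Re s = c"
  shows "norm (exp (- s * of_real t) * (\<mu> t - m)) \<le> C * exp (- \<kappa> * \<bar>t\<bar>)"
    and "integrable lborel (\<lambda>t. exp (- s * of_real t) * (\<mu> t - m))"
proof -
  show bound: "norm (exp (- s * of_real t) * (\<mu> t - m)) \<le> C * exp (- \<kappa> * \<bar>t\<bar>)" for t
  proof -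
    have "norm (exp (- s * of_real t) * (\<mu> t - m)) \<le> exp (- c * t) * (C * exp (c * t - \<kappa> * \<bar>t\<bar>))"
      using C[of t] by (simp add: norm_mult s mult_left_mono)
    also have "\<dots> = C * exp (- c * t + (c * t - \<kappa> * \<bar>t\<bar>))" unfolding exp_add by simp
    finally show ?thesis by simp
  qed
  have [measurable]: "\<mu> \<in> borel_measurable borel"
    by (intro midpoint_regular_borel_measurable determining_function_midpoint_regular \<mu>)
  show "integrable lborel (\<lambda>t. exp (- s * of_real t) * (\<mu> t - m))"
  proof (rule Bochner_Integration.integrable_bound)
    show "integrable lborel (\<lambda>t. C * exp (- \<kappa> * \<bar>t\<bar>))"
      by (intro integrable_mult_right integrable_exp_neg_abs \<kappa>)
    show "AE t in lborel. norm (exp (- s * of_real t) * (\<mu> t - m)) \<le> norm (C * exp (- \<kappa> * \<bar>t\<bar>))"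
      using bound by (intro AE_I2) (simp add: order_trans[OF _ abs_ge_self])
  qed measurable
qed

text \<open>Integration by parts on \<open>{-v..0}\<close> and \<open>{0..v}\<close>: the boundary
  terms at 0 cancel, those at v and -v vanish in the limit by the decay of h. A possibly
  conditionally convergent integral becomes an absolutely convergent one.\<close>

lemma laplace_stieltjes_eq_lebesgue:
  fixes \<mu> :: "real \<Rightarrow> complex" and c \<kappa> :: real
  assumes \<mu>: "determining_function \<mu>" and \<kappa>: "\<kappa> > 0"
    and C: "\<And>t. norm (\<mu> t - m) \<le> C * exp (c * t - \<kappa> * \<bar>t\<bar>)"
    and s: "Re s = c" and L: "has_laplace_stieltjes \<mu> s L"
  shows "L = s * (\<integral>t. exp (- s * of_real t) * (\<mu> t - m) \<partial>lborel)"
proof -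
  define h where "h t = exp (- s * of_real t) * (\<mu> t - m)" for t
  have h_bound: "norm (h t) \<le> C * exp (- \<kappa> * \<bar>t\<bar>)" for t
    unfolding h_def by (rule exp_mult_determining_function_integrable(1)[OF \<mu> \<kappa> C s])
  have h_int: "integrable lborel h"
    unfolding h_def by (rule exp_mult_determining_function_integrable(2)[OF \<mu> \<kappa> C s])
  obtain G H l r where
    G: "\<And>v. v \<ge> 0 \<Longrightarrow> has_stieltjes_integral (\<lambda>t. exp (- s * of_real t)) \<mu> 0 v (G v)" and
    H: "\<And>u. u \<le> 0 \<Longrightarrow> has_stieltjes_integral (\<lambda>t. exp (- s * of_real t)) \<mu> u 0 (H u)" and
    lim: "(G \<longlongrightarrow> r) at_top" "(H \<longlongrightarrow> l) at_bot" and L_eq: "L = l + r"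
    using L unfolding has_laplace_stieltjes_def by blast
  have "((\<lambda>v. H (- v) + G v) \<longlongrightarrow> L) at_top"
    unfolding L_eq
    by (intro tendsto_add lim filterlim_compose[OF lim(2)] filterlim_uminus_at_bot_at_top)
  moreover have "((\<lambda>v. h v - h (- v) + s * integral {-v..v} h) \<longlongrightarrow> 0 - 0 + s * (\<integral>t. h t \<partial>lborel)) at_top"
  proof (intro tendsto_intros integral_symmetric_tendsto[OF h_int])
    have *: "((\<lambda>t. C * exp (- \<kappa> * t)) \<longlongrightarrow> 0) at_top"
      using \<kappa> by real_asymp
    show "(h \<longlongrightarrow> 0) at_top"
      by (rule Lim_null_comparison[OF _ *], use eventually_ge_at_top[of 0] in eventually_elim)
         (metis h_bound abs_of_nonneg)
    show "((\<lambda>v. h (- v)) \<longlongrightarrow> 0) at_top"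
      by (rule Lim_null_comparison[OF _ *], use eventually_ge_at_top[of 0] in eventually_elim)
         (metis h_bound abs_of_nonneg abs_minus_cancel)
  qed
  moreover have "eventually (\<lambda>v. H (- v) + G v = h v - h (- v) + s * integral {-v..v} h) at_top"
    using eventually_gt_at_top[of 0]
  proof eventually_elim
    fix v :: real assume v: "v > 0"
    have "((\<lambda>t. s * h t) has_integral (H (- v) + h (- v) - h 0) + (G v + h 0 - h v)) {-v..v}"
    proof (rule has_integral_combine)
      show "((\<lambda>t. s * h t) has_integral (H (- v) + h (- v) - h 0)) {-v..0}"
        unfolding h_def using laplace_stieltjes_by_parts[OF \<mu> _ _ H, of "- v" m] v by simp
      show "((\<lambda>t. s * h t) has_integral (G v + h 0 - h v)) {0..v}"
        unfolding h_def using laplace_stieltjes_by_parts[OF \<mu> _ _ G, of v m] v by simp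
    qed (use v in auto)
    from integral_unique[OF this] show "H (- v) + G v = h v - h (- v) + s * integral {-v..v} h"
      by (simp add: algebra_simps)
  qed
  ultimately have "((\<lambda>v. H (- v) + G v) \<longlongrightarrow> 0 - 0 + s * (\<integral>t. h t \<partial>lborel)) at_top"
    "((\<lambda>v. H (- v) + G v) \<longlongrightarrow> L) at_top"
    by (auto elim: Lim_transform_eventually simp: eq_commute)
  from tendsto_unique[OF _ this] show ?thesis by (simp add: h_def)
qed

section \<open>Phragmen--Lindelof on a strip\<close>

text \<open>The maximum principle is applied to \<open>H\<close> times \<open>exp (- \<delta> cos (k (s - w)))\<close>, with w the midpoint
  of the strip and k slightly larger than K: on the strip the real part of the cosine is at least a
  positive multiple of \<open>exp (k \<bar>Im s\<bar>)\<close>, which beats the growth of H. Then \<open>\<delta>\<close> tends to 0.\<close>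

lemma phragmen_lindelof_strip:
  fixes H :: "complex \<Rightarrow> complex" and A B C K c d :: real
  assumes "open S" and holo: "H holomorphic_on S" and sub: "{s. c \<le> Re s \<and> Re s \<le> d} \<subseteq> S"
    and cd: "c < d" and K: "0 < K" "K * (d - c) < pi" and "B > 0" and "C > 0"
    and growth: "\<And>s. c \<le> Re s \<Longrightarrow> Re s \<le> d \<Longrightarrow> norm (H s) \<le> A * exp (B * exp (K * \<bar>Im s\<bar>))"
    and edges: "\<And>s. Re s = c \<or> Re s = d \<Longrightarrow> norm (H s) \<le> C"
    and s: "c \<le> Re s" "Re s \<le> d"
  shows "norm (H s) \<le> C"
proof -
  have "K < pi / (d - c)" using K cd by (simp add: pos_less_divide_eq)
  then obtain k where k: "K < k" "k < pi / (d - c)" using dense by blast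
  define w where "w = (c + d) / 2"
  \<comment> \<open>The minimum of \<open>cos (k * (x - w))\<close> over the strip, attained at the
    edges; it is positive because \<open>k < pi / (d - c)\<close> keeps the argument below
    \<open>pi / 2\<close>.\<close>
  define \<kappa> where "\<kappa> = cos (k * ((d - c) / 2))"
  have k0: "k > 0" using k K by simp
  have half: "0 < k * ((d - c) / 2)" "k * ((d - c) / 2) < pi / 2"
    using k k0 cd by (simp_all add: pos_less_divide_eq)
  have \<kappa>: "\<kappa> > 0" unfolding \<kappa>_def by (rule cos_gt_zero) (use half in auto)
  define q where "q z = cos (of_real k * (z - of_real w))" for z :: complex
  \<comment> \<open>The real part of \<open>cos (x + i y)\<close> is \<open>cos x * cosh y\<close>;
    the first factor is at least \<kappa>, and cosh is at least half of its larger
    exponential.\<close>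
  have q: "Re (q z) \<ge> \<kappa> / 2 * exp (k * \<bar>Im z\<bar>)" if "c \<le> Re z" "Re z \<le> d" for z
  proof -
    have "k * \<bar>Re z - w\<bar> \<le> k * ((d - c) / 2)"
      using that k0 unfolding w_def by (intro mult_left_mono) (auto simp: abs_le_iff field_simps)
    then have "\<bar>k * (Re z - w)\<bar> \<le> k * ((d - c) / 2)"
      using k0 by (simp add: abs_mult)
    then have "\<kappa> \<le> cos \<bar>k * (Re z - w)\<bar>"
      unfolding \<kappa>_def using half by (intro cos_monotone_0_pi_le) auto
    then have 1: "\<kappa> \<le> cos (k * (Re z - w))" by simp
    have "k * \<bar>Im z\<bar> = k * Im z \<or> k * \<bar>Im z\<bar> = - (k * Im z)" by (simp add: abs_if)
    then have 2: "exp (k * \<bar>Im z\<bar>) / 2 \<le> (exp (k * Im z) + exp (- (k * Im z))) / 2"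
      by (auto simp: add_pos_pos less_imp_le)
    have "\<kappa> * (exp (k * \<bar>Im z\<bar>) / 2) \<le> cos (k * (Re z - w)) * ((exp (k * Im z) + exp (- (k * Im z))) / 2)"
      using 1 2 \<kappa> by (intro mult_mono) auto
    then show ?thesis by (simp add: q_def Re_cos)
  qed
  have bound: "norm (H s * exp (- of_real \<delta> * q s)) \<le> C" if \<delta>: "\<delta> > 0" for \<delta>
  proof -
    define g where "g z = H z * exp (- of_real \<delta> * q z)" for z
    have g: "norm (g z) \<le> norm (H z) * exp (- (\<delta> * \<kappa> / 2) * exp (k * \<bar>Im z\<bar>))"
      if "c \<le> Re z" "Re z \<le> d" for z
      unfolding g_def using mult_left_mono[OF q[OF that], of \<delta>] \<delta>
      by (auto simp: norm_mult intro!: mult_left_mono)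
    \<comment> \<open>Since k = K + j, the total exponent at height T is
      \<open>exp (K * T) * (B - \<delta> * \<kappa> / 2 * exp (j * T))\<close>. T is taken so large
      that the bracket is at most -1, the resulting bound falls below C, and the rectangle contains
      s.\<close>
    define j where "j = k - K"
    have j: "j > 0" using k by (simp add: j_def)
    have "filterlim (\<lambda>T. B - \<delta> * \<kappa> / 2 * exp (j * T)) at_bot at_top"
      using \<delta> \<kappa> j by real_asymp
    then have "eventually (\<lambda>T. B - \<delta> * \<kappa> / 2 * exp (j * T) \<le> - 1) at_top"
      by (simp add: filterlim_at_bot)
    moreover have "((\<lambda>T. \<bar>A\<bar> * exp (- exp (K * T))) \<longlongrightarrow> 0) at_top"
      using K(1) by real_asymp
    then have "eventually (\<lambda>T. \<bar>A\<bar> * exp (- exp (K * T)) < C) at_top"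
      using \<open>C > 0\<close> by (rule order_tendstoD(2))
    moreover have "eventually (\<lambda>T. \<bar>Im s\<bar> \<le> T) at_top" by (rule eventually_ge_at_top)
    ultimately have "eventually (\<lambda>T. B - \<delta> * \<kappa> / 2 * exp (j * T) \<le> - 1 \<and> \<bar>A\<bar> * exp (- exp (K * T)) < C \<and> \<bar>Im s\<bar> \<le> T) at_top"
      by (intro eventually_conj)
    then obtain T where T: "B - \<delta> * \<kappa> / 2 * exp (j * T) \<le> - 1" "\<bar>A\<bar> * exp (- exp (K * T)) < C" "\<bar>Im s\<bar> \<le> T"
      by (auto dest: eventually_happens)
    have top: "norm (g z) \<le> C" if z: "c \<le> Re z" "Re z \<le> d" "\<bar>Im z\<bar> = T" for z
    proof -
      have "exp (K * T) * (B - \<delta> * \<kappa> / 2 * exp (j * T)) \<le> exp (K * T) * (- 1)"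
        by (intro mult_left_mono T) auto
      moreover have "exp (k * T) = exp (K * T) * exp (j * T)"
        by (simp add: j_def algebra_simps flip: exp_add)
      ultimately have e: "B * exp (K * T) + - (\<delta> * \<kappa> / 2) * exp (k * T) \<le> - exp (K * T)"
        by (simp add: algebra_simps)
      have "norm (g z) \<le> \<bar>A\<bar> * exp (B * exp (K * T)) * exp (- (\<delta> * \<kappa> / 2) * exp (k * T))"
        using g[OF z(1,2)] growth[OF z(1,2)] unfolding z(3)
        by (elim order_trans) (auto intro!: mult_right_mono elim!: order_trans)
      also have "\<dots> = \<bar>A\<bar> * exp (B * exp (K * T) + - (\<delta> * \<kappa> / 2) * exp (k * T))"
        unfolding exp_add by simp
      also have "\<dots> \<le> \<bar>A\<bar> * exp (- exp (K * T))"
        using e by (intro mult_left_mono) auto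
      finally show ?thesis using T(2) by simp
    qed
    have side: "norm (g z) \<le> C" if z: "Re z = c \<or> Re z = d" for z
    proof -
      have "norm (g z) \<le> norm (H z) * exp (- (\<delta> * \<kappa> / 2) * exp (k * \<bar>Im z\<bar>))"
        using g[of z] z cd by auto
      also have "\<dots> \<le> C * 1"
        using edges[OF z] \<delta> \<kappa> \<open>C > 0\<close> by (intro mult_mono) auto
      finally show ?thesis by simp
    qed
    let ?R = "cbox (Complex c (- T)) (Complex d T)"
    have R_sub: "?R \<subseteq> S" using sub by (auto simp: in_cbox_complex_iff)
    have g_holo: "g holomorphic_on S"
      unfolding g_def q_def by (intro holomorphic_intros holo)
    have "norm (g s) \<le> C"
    proof (rule maximum_modulus_frontier[where S = ?R and f = g and \<xi> = s])
      show "g holomorphic_on (interior ?R)"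
        by (rule holomorphic_on_subset[OF g_holo]) (use R_sub interior_subset in blast)
      show "continuous_on (closure ?R) g"
        using holomorphic_on_imp_continuous_on[OF g_holo] R_sub by (simp add: continuous_on_subset)
      show "norm (g z) \<le> C" if "z \<in> frontier ?R" for z
      proof -
        have z: "z \<in> ?R" "z \<notin> box (Complex c (- T)) (Complex d T)"
          using that by (auto simp: frontier_cbox)
        then have "Re z = c \<or> Re z = d \<or> \<bar>Im z\<bar> = T"
          by (auto simp: in_cbox_complex_iff in_box_complex_iff)
        then show ?thesis using side[of z] top[of z] z by (auto simp: in_cbox_complex_iff)
      qed
      show "s \<in> ?R" using s T(3) by (auto simp: in_cbox_complex_iff)
    qed simp
    then show ?thesis by (simp add: g_def)
  qed
  have "((\<lambda>\<delta>. norm (H s * exp (- of_real \<delta> * q s))) \<longlongrightarrow> norm (H s * exp (- of_real 0 * q s))) (at_right 0)"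
    by (intro tendsto_intros)
  moreover have "eventually (\<lambda>\<delta>. norm (H s * exp (- of_real \<delta> * q s)) \<le> C) (at_right 0)"
    using eventually_at_right_less[of 0] by eventually_elim (rule bound)
  ultimately have "norm (H s * exp (- of_real 0 * q s)) \<le> C"
    by (rule tendsto_upperbound) simp
  then show ?thesis by simp
qed

section \<open>From the growth condition to a linear bound\<close>

lemma open_vertical_strip: "open (vertical_strip a b)"
proof -
  have "vertical_strip a b = (\<lambda>s. ereal (Re s)) -` {a<..<b}"
    by (auto simp: vertical_strip_def)
  moreover have "open \<dots>"
    by (intro open_vimage continuous_intros open_greaterThanLessThan)
  ultimately show ?thesis by simp
qed

lemma phragmen_lindelof_linear_bound:
  fixes a b :: ereal and c d :: real
  assumes holo: "F holomorphic_on vertical_strip a b" and PL: "phragmen_lindelof F a b"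
    and cd: "a < ereal c" "c < d" "ereal d < b"
    and edges: "\<And>s. Re s = c \<or> Re s = d \<Longrightarrow> norm (F s) \<le> C0 * norm s"
  shows "\<exists>C. \<forall>s. c \<le> Re s \<and> Re s \<le> d \<longrightarrow> norm (F s) \<le> C * (1 + norm s)"
proof -
  obtain A B Y K :: real where *: "A > 0" "B > 0" "Y > 0" "0 < K" "ereal K < ereal pi / \<bar>b - a\<bar>"
    and gr: "\<And>x y. a < ereal x \<Longrightarrow> ereal x < b \<Longrightarrow> \<bar>y\<bar> \<ge> Y \<Longrightarrow>
       norm (F (Complex x y)) \<le> A * exp (B * exp (K * \<bar>y\<bar>))"
    using PL unfolding phragmen_lindelof_def by blast
  \<comment> \<open>For finite a and b the inner strip is narrower, so the restriction on K carries
    over; an infinite width would make the bound on K equal to 0.\<close>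
  have Kcd: "K * (d - c) < pi"
  proof (cases a; cases b)
    fix a' b' assume ab: "a = ereal a'" "b = ereal b'"
    then have "a' < c" "d < b'" using cd by auto
    moreover have "K < pi / (b' - a')"
      using *(5) ab \<open>a' < c\<close> \<open>d < b'\<close> cd by simp
    then have "K * (b' - a') < pi" using \<open>a' < c\<close> \<open>d < b'\<close> cd by (simp add: pos_less_divide_eq)
    moreover have "K * (d - c) \<le> K * (b' - a')"
      using \<open>a' < c\<close> \<open>d < b'\<close> *(4) by (intro mult_left_mono) auto
    ultimately show ?thesis by linarith
  qed (use * cd in auto)
  \<comment> \<open>Dividing by \<open>s - p\<close> turns the linear edge bounds into constant
    ones. With p one unit to the left of the inner strip the divisor has norm at least 1 there; p
    itself may lie in the larger strip and is removed from \<open>S\<close>.\<close>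
  define p where "p = c - 1"
  define S where "S = vertical_strip a b - {of_real p}"
  have strip: "s \<in> vertical_strip a b" if "c \<le> Re s" "Re s \<le> d" for s
    using that cd less_le_trans[of a c "Re s"] le_less_trans[of "Re s" d b]
    by (auto simp: vertical_strip_def)
  define R where "R = cbox (Complex c (- Y)) (Complex d Y)"
  have "continuous_on R F"
    by (rule continuous_on_subset[OF holomorphic_on_imp_continuous_on[OF holo]])
       (auto simp: R_def in_cbox_complex_iff intro: strip)
  then have "bounded (F ` R)"
    unfolding R_def by (intro compact_imp_bounded compact_continuous_image) auto
  then obtain M where M: "\<And>s. s \<in> R \<Longrightarrow> norm (F s) \<le> M" unfolding bounded_iff by blast
  \<comment> \<open>Below height Y the growth condition is silent; there the compact rectangle
    \<open>R\<close> gives M, and the double exponential is at least 1.\<close>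
  have growth: "norm (F s) \<le> max A M * exp (B * exp (K * \<bar>Im s\<bar>))" if s: "c \<le> Re s" "Re s \<le> d" for s
  proof (cases "\<bar>Im s\<bar> \<ge> Y")
    case True
    have "norm (F s) \<le> A * exp (B * exp (K * \<bar>Im s\<bar>))"
      using gr[OF _ _ True, of "Re s"] strip[OF s] by (auto simp: vertical_strip_def)
    then show ?thesis by (rule order_trans) (intro mult_right_mono, auto)
  next
    case False
    have "norm (F s) \<le> M" using s False by (intro M) (auto simp: R_def in_cbox_complex_iff)
    also have "\<dots> \<le> max A M * 1" by simp
    also have "\<dots> \<le> max A M * exp (B * exp (K * \<bar>Im s\<bar>))"
      using * by (intro mult_left_mono) auto
    finally show ?thesis .
  qed
  have dist1: "norm (s - of_real p) \<ge> 1" if "c \<le> Re s" for s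
    using that abs_Re_le_cmod[of "s - of_real p"] by (simp add: p_def)
  \<comment> \<open>From \<open>norm s <= norm (s - p) + \<bar>p\<bar> <= (1 + \<bar>p\<bar>) * norm
    (s - p)\<close>; the summand 1 makes C positive.\<close>
  define C where "C = \<bar>C0\<bar> * (1 + \<bar>p\<bar>) + 1"
  have main: "norm (F s / (s - of_real p)) \<le> C" if s: "c \<le> Re s" "Re s \<le> d" for s
  proof (rule phragmen_lindelof_strip[where S = S and H = "\<lambda>s. F s / (s - of_real p)" and A = "max A M", OF _ _ _ cd(2) *(4) Kcd *(2) _ _ _ s])
    show "open S" unfolding S_def by (intro open_Diff open_vertical_strip) auto
    show "(\<lambda>s. F s / (s - of_real p)) holomorphic_on S"
      unfolding S_def by (intro holomorphic_intros holomorphic_on_subset[OF holo]) auto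
    show "{s. c \<le> Re s \<and> Re s \<le> d} \<subseteq> S"
      using strip by (auto simp: S_def p_def)
    show "C > 0" by (simp add: C_def add_nonneg_pos)
    show "norm (F s / (s - of_real p)) \<le> max A M * exp (B * exp (K * \<bar>Im s\<bar>))" if "c \<le> Re s" "Re s \<le> d" for s
    proof -
      have "norm (F s / (s - of_real p)) \<le> norm (F s) / 1"
        unfolding norm_divide using dist1[OF that(1)] by (intro divide_left_mono) auto
      then show ?thesis using growth[OF that] by simp
    qed
    show "norm (F s / (s - of_real p)) \<le> C" if "Re s = c \<or> Re s = d" for s
    proof -
      have 1: "norm (s - of_real p) \<ge> 1" using that cd by (intro dist1) auto
      have "norm (F s) \<le> \<bar>C0\<bar> * norm s"
        using edges[OF that] mult_right_mono[OF abs_ge_self[of C0], of "norm s"] by simp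
      also have "norm s \<le> norm (s - of_real p) + \<bar>p\<bar>"
        using norm_triangle_ineq[of "s - of_real p" "of_real p"] by simp
      also have "\<dots> \<le> norm (s - of_real p) + \<bar>p\<bar> * norm (s - of_real p)"
        using 1 mult_left_mono[OF 1, of "\<bar>p\<bar>"] by simp
      finally have "norm (F s) \<le> \<bar>C0\<bar> * (norm (s - of_real p) + \<bar>p\<bar> * norm (s - of_real p))"
        by (simp add: mult_left_mono)
      also have "\<dots> \<le> C * norm (s - of_real p)"
        by (simp add: C_def algebra_simps)
      finally have "norm (F s) \<le> C * norm (s - of_real p)" .
      moreover have "norm (s - of_real p) > 0" using 1 by linarith
      ultimately show ?thesis unfolding norm_divide by (simp add: pos_divide_le_eq)
    qed
  qed
  have "norm (F s) \<le> C * (1 + \<bar>p\<bar>) * (1 + norm s)" if s: "c \<le> Re s" "Re s \<le> d" for s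
  proof -
    have "norm (s - of_real p) > 0" using dist1[OF s(1)] by linarith
    then have "norm (F s) \<le> C * norm (s - of_real p)"
      using main[OF s] unfolding norm_divide by (simp add: pos_divide_le_eq)
    also have "norm (s - of_real p) \<le> norm s + \<bar>p\<bar>"
      using norm_triangle_ineq4[of s "of_real p"] by simp
    also have "\<dots> \<le> (1 + \<bar>p\<bar>) * (1 + norm s)" by (simp add: algebra_simps)
    finally show ?thesis by (simp add: C_def mult_left_mono mult.assoc)
  qed
  then show ?thesis by blast
qed

section \<open>Gaussian inversion on a vertical line\<close>

text \<open>Scaling by \<sigma> turns the integral into the characteristic function of the standard
  normal distribution at \<open>w / \<sigma>\<close>.\<close>

lemma integral_gaussian_iexp:
  fixes \<sigma> w :: real
  assumes "\<sigma> > 0"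
  shows "integrable lborel (\<lambda>y. of_real (exp (- (\<sigma>\<^sup>2 * y\<^sup>2 / 2))) * iexp (y * w))"
    and "(\<integral>y. of_real (exp (- (\<sigma>\<^sup>2 * y\<^sup>2 / 2))) * iexp (y * w) \<partial>lborel) =
      of_real (sqrt (2 * pi) / \<sigma> * exp (- w\<^sup>2 / (2 * \<sigma>\<^sup>2)))"
proof -
  define g where "g x = std_normal_density x *\<^sub>R iexp (w / \<sigma> * x)" for x
  have [measurable]: "g \<in> borel_measurable borel" unfolding g_def by measurable
  have g_int: "integrable lborel g"
    by (rule Bochner_Integration.integrable_bound[OF integrable_normal_density[OF zero_less_one, of 0]])
       (auto simp: g_def)
  have "(\<integral>x. g x \<partial>lborel) = char std_normal_distribution (w / \<sigma>)"
    unfolding char_def g_def by (subst integral_density) auto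
  also have "\<dots> = of_real (exp (- w\<^sup>2 / (2 * \<sigma>\<^sup>2)))"
    by (simp add: char_std_normal_distribution power_divide)
  finally have g_eq: "(\<integral>x. g x \<partial>lborel) = of_real (exp (- w\<^sup>2 / (2 * \<sigma>\<^sup>2)))" .
  have *: "of_real (exp (- (\<sigma>\<^sup>2 * y\<^sup>2 / 2))) * iexp (y * w) = of_real (sqrt (2 * pi)) * g (0 + \<sigma> * y)" for y
    using assms by (simp add: g_def std_normal_density_def scaleR_conv_of_real power_mult_distrib mult_ac
        real_sqrt_mult del: of_real_exp)
  show "integrable lborel (\<lambda>y. of_real (exp (- (\<sigma>\<^sup>2 * y\<^sup>2 / 2))) * iexp (y * w))"
    unfolding * using lborel_integrable_real_affine[OF g_int, of \<sigma> 0] assms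
    by (intro integrable_mult_right) auto
  have "(\<integral>x. g x \<partial>lborel) = \<sigma> *\<^sub>R (\<integral>y. g (0 + \<sigma> * y) \<partial>lborel)"
    using assms by (subst lborel_integral_real_affine[of \<sigma> g 0]) auto
  then have "(\<integral>y. g (0 + \<sigma> * y) \<partial>lborel) = of_real (exp (- w\<^sup>2 / (2 * \<sigma>\<^sup>2))) / of_real \<sigma>"
    using assms unfolding g_eq by (simp add: scaleR_conv_of_real field_simps del: of_real_exp)
  then show "(\<integral>y. of_real (exp (- (\<sigma>\<^sup>2 * y\<^sup>2 / 2))) * iexp (y * w) \<partial>lborel) =
      of_real (sqrt (2 * pi) / \<sigma> * exp (- w\<^sup>2 / (2 * \<sigma>\<^sup>2)))"
    unfolding * by simp
qed

text \<open>The bilateral Laplace transform of the centred normal density with standard deviation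
  \<sigma>, times the translation factor \<open>exp (s * x)\<close>.\<close>

definition gauss :: "real \<Rightarrow> real \<Rightarrow> complex \<Rightarrow> complex" where
  "gauss \<sigma> x s = exp (of_real (\<sigma>\<^sup>2) * s\<^sup>2 / 2 + s * of_real x)"

lemma gauss_Complex:
  "gauss \<sigma> x (Complex c y) = of_real (exp (\<sigma>\<^sup>2 * c\<^sup>2 / 2 + c * x)) *
     (of_real (exp (- (\<sigma>\<^sup>2 * y\<^sup>2 / 2))) * iexp (y * (\<sigma>\<^sup>2 * c + x)))"
  unfolding gauss_def exp_of_real[symmetric] exp_add[symmetric]
  by (rule arg_cong[of _ _ exp]) (simp add: complex_eq_iff power2_eq_square field_simps)

lemma norm_gauss:
  "norm (gauss \<sigma> x s) = exp (\<sigma>\<^sup>2 * ((Re s)\<^sup>2 - (Im s)\<^sup>2) / 2 + Re s * x)"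
  by (simp add: gauss_def power2_eq_square)

lemma gauss_integrable:
  assumes "\<sigma> > 0"
  shows "integrable lborel (\<lambda>y. gauss \<sigma> x (Complex c y))"
  unfolding gauss_Complex by (intro integrable_mult_right integral_gaussian_iexp assms)

lemma integral_gauss:
  assumes "\<sigma> > 0"
  shows "(\<integral>y. gauss \<sigma> x (Complex c y) \<partial>lborel) = of_real (2 * pi * normal_density 0 \<sigma> x)"
proof -
  let ?w = "\<sigma>\<^sup>2 * c + x"
  have "(\<integral>y. gauss \<sigma> x (Complex c y) \<partial>lborel) =
     of_real (exp (\<sigma>\<^sup>2 * c\<^sup>2 / 2 + c * x) * (sqrt (2 * pi) / \<sigma> * exp (- ?w\<^sup>2 / (2 * \<sigma>\<^sup>2))))"
    unfolding gauss_Complex using integral_gaussian_iexp(2)[OF assms, of ?w] by simp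
  also have "exp (\<sigma>\<^sup>2 * c\<^sup>2 / 2 + c * x) * (sqrt (2 * pi) / \<sigma> * exp (- ?w\<^sup>2 / (2 * \<sigma>\<^sup>2))) =
     sqrt (2 * pi) / \<sigma> * exp (\<sigma>\<^sup>2 * c\<^sup>2 / 2 + c * x + - ?w\<^sup>2 / (2 * \<sigma>\<^sup>2))"
    unfolding exp_add by simp
  \<comment> \<open>Completing the square removes c: the integral is the same on every vertical
    line.\<close>
  also have "\<sigma>\<^sup>2 * c\<^sup>2 / 2 + c * x + - ?w\<^sup>2 / (2 * \<sigma>\<^sup>2) = - x\<^sup>2 / (2 * \<sigma>\<^sup>2)"
    using assms by (simp add: field_simps power2_eq_square)
  also have "sqrt (2 * pi) / \<sigma> * exp (- x\<^sup>2 / (2 * \<sigma>\<^sup>2)) = 2 * pi * normal_density 0 \<sigma> x"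
  proof -
    have "2 * pi = sqrt (2 * pi) * sqrt (2 * pi)" by simp
    then have "sqrt (2 * pi) / \<sigma> = 2 * pi * (1 / (sqrt (2 * pi) * \<sigma>))"
      using assms by (simp add: divide_simps)
    moreover have "sqrt (2 * pi * \<sigma>\<^sup>2) = sqrt (2 * pi) * \<sigma>"
      using assms by (simp add: real_sqrt_mult)
    ultimately show ?thesis by (simp add: normal_density_def)
  qed
  finally show ?thesis .
qed

text \<open>Multiplying the kernel by \<open>exp (- s * \<tau>)\<close> only shifts its parameter
  from t to \<open>t - \<tau>\<close>. Hence Fubini reduces the claim to
  \<open>integral_gauss\<close>; absolute convergence holds because the norm of the integrand is a
  product of functions of y and of \<tau>.\<close>

lemma gauss_laplace:
  fixes f :: "real \<Rightarrow> complex" and c \<sigma> t :: real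
  defines "\<Phi> \<equiv> \<lambda>s. \<integral>\<tau>. exp (- s * of_real \<tau>) * f \<tau> \<partial>lborel"
  assumes \<sigma>: "\<sigma> > 0" and f: "integrable lborel (\<lambda>\<tau>. of_real (exp (- c * \<tau>)) * f \<tau>)"
    and [measurable]: "f \<in> borel_measurable borel"
  shows "integrable lborel (\<lambda>y. gauss \<sigma> t (Complex c y) * \<Phi> (Complex c y))"
    and "(\<integral>y. gauss \<sigma> t (Complex c y) * \<Phi> (Complex c y) \<partial>lborel) =
      of_real (2 * pi) * (\<integral>\<tau>. of_real (normal_density 0 \<sigma> (t - \<tau>)) * f \<tau> \<partial>lborel)"
proof -
  define g where "g y \<tau> = gauss \<sigma> t (Complex c y) * (exp (- Complex c y * of_real \<tau>) * f \<tau>)" for y \<tau>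
  have Complex_eq': "Complex c y = of_real c + \<i> * of_real y" for y by (simp add: complex_eq_iff)
  have fn: "integrable lborel (\<lambda>\<tau>. exp (- c * \<tau>) * norm (f \<tau>))"
    using integrable_norm[OF f] by (simp add: norm_mult)
  have g_norm: "norm (g y \<tau>) = norm (gauss \<sigma> t (Complex c y)) * (exp (- c * \<tau>) * norm (f \<tau>))" for y \<tau>
    by (simp add: g_def norm_mult)
  have g_meas: "case_prod g \<in> borel_measurable (lborel \<Otimes>\<^sub>M lborel)"
    unfolding g_def gauss_def Complex_eq' by measurable
  have g_int: "integrable (lborel \<Otimes>\<^sub>M lborel) (case_prod g)"
  proof (rule lborel_pair.Fubini_integrable[OF g_meas])
    show "integrable lborel (\<lambda>y. \<integral>\<tau>. norm (case (y, \<tau>) of (y, \<tau>) \<Rightarrow> g y \<tau>) \<partial>lborel)"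
      unfolding prod.case g_norm
      using integrable_norm[OF gauss_integrable[OF \<sigma>, of t c]] by simp
    show "AE y in lborel. integrable lborel (\<lambda>\<tau>. case (y, \<tau>) of (y, \<tau>) \<Rightarrow> g y \<tau>)"
    proof (rule AE_I2, unfold prod.case)
      fix y :: real
      show "integrable lborel (g y)"
      proof (rule Bochner_Integration.integrable_bound)
        show "integrable lborel (\<lambda>\<tau>. norm (gauss \<sigma> t (Complex c y)) * (exp (- c * \<tau>) * norm (f \<tau>)))"
          by (intro integrable_mult_right fn)
        show "g y \<in> borel_measurable lborel" unfolding g_def by measurable
        show "AE \<tau> in lborel. norm (g y \<tau>) \<le> norm (norm (gauss \<sigma> t (Complex c y)) * (exp (- c * \<tau>) * norm (f \<tau>)))"
          unfolding g_norm by simp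
      qed
    qed
  qed
  have 1: "(\<integral>\<tau>. g y \<tau> \<partial>lborel) = gauss \<sigma> t (Complex c y) * \<Phi> (Complex c y)" for y
    unfolding g_def \<Phi>_def by simp
  have "g y \<tau> = gauss \<sigma> (t - \<tau>) (Complex c y) * f \<tau>" for y \<tau>
    unfolding g_def gauss_def mult.assoc[symmetric] exp_add[symmetric] by (simp add: algebra_simps)
  then have 2: "(\<integral>y. g y \<tau> \<partial>lborel) = of_real (2 * pi * normal_density 0 \<sigma> (t - \<tau>)) * f \<tau>" for \<tau>
    by (simp add: integral_gauss[OF \<sigma>])
  show "integrable lborel (\<lambda>y. gauss \<sigma> t (Complex c y) * \<Phi> (Complex c y))"
    using lborel_pair.integrable_fst'[OF g_int] by (simp add: 1)
  have "(\<integral>y. gauss \<sigma> t (Complex c y) * \<Phi> (Complex c y) \<partial>lborel) = (\<integral>y. (\<integral>\<tau>. g y \<tau> \<partial>lborel) \<partial>lborel)"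
    by (simp add: 1)
  also have "\<dots> = (\<integral>\<tau>. (\<integral>y. g y \<tau> \<partial>lborel) \<partial>lborel)"
    by (rule lborel_pair.Fubini_integral[OF g_int, symmetric])
  also have "\<dots> = of_real (2 * pi) * (\<integral>\<tau>. of_real (normal_density 0 \<sigma> (t - \<tau>)) * f \<tau> \<partial>lborel)"
    unfolding 2 by (simp add: mult.assoc)
  finally show "(\<integral>y. gauss \<sigma> t (Complex c y) * \<Phi> (Complex c y) \<partial>lborel) =
      of_real (2 * pi) * (\<integral>\<tau>. of_real (normal_density 0 \<sigma> (t - \<tau>)) * f \<tau> \<partial>lborel)" .
qed

section \<open>Shifting the line of integration\<close>

lemma norm_gauss_strip_le:
  assumes "\<bar>Re s\<bar> \<le> M"
  shows "norm (gauss \<sigma> t s) \<le> exp (\<sigma>\<^sup>2 * M\<^sup>2 / 2 + M * \<bar>t\<bar>) * exp (- (\<sigma>\<^sup>2 * (Im s)\<^sup>2 / 2))"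
proof -
  have "(Re s)\<^sup>2 \<le> M\<^sup>2" using assms abs_le_square_iff[of "Re s" M] by simp
  then have "\<sigma>\<^sup>2 * (Re s)\<^sup>2 \<le> \<sigma>\<^sup>2 * M\<^sup>2" by (intro mult_left_mono) auto
  moreover have "Re s * t \<le> M * \<bar>t\<bar>"
    using abs_ge_self[of "Re s * t"] mult_right_mono[OF assms, of "\<bar>t\<bar>"] by (simp add: abs_mult)
  ultimately have "\<sigma>\<^sup>2 * ((Re s)\<^sup>2 - (Im s)\<^sup>2) / 2 + Re s * t
      \<le> (\<sigma>\<^sup>2 * M\<^sup>2 / 2 + M * \<bar>t\<bar>) + - (\<sigma>\<^sup>2 * (Im s)\<^sup>2 / 2)"
    by (simp add: right_diff_distrib diff_divide_distrib)
  then show ?thesis unfolding norm_gauss exp_add[symmetric] by simp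
qed

text \<open>Cauchy's integral formula on the rectangle between the two lines. As
  \<open>gauss \<sigma> t 0 = 1\<close>, the value at the pole is \<open>F 0\<close> alone; the
  linear bound makes \<open>F s / s\<close> bounded on the horizontal sides, where the Gaussian then
  wins.\<close>

lemma contour_shift_gauss:
  fixes F :: "complex \<Rightarrow> complex" and c d \<sigma> t C :: real
  assumes \<sigma>: "\<sigma> > 0" and cd: "c < 0" "0 < d"
    and S: "open S" "convex S" "{s. c \<le> Re s \<and> Re s \<le> d} \<subseteq> S" and holo: "F holomorphic_on S"
    and lin: "\<And>s. c \<le> Re s \<Longrightarrow> Re s \<le> d \<Longrightarrow> norm (F s) \<le> C * (1 + norm s)"
    and intc: "integrable lborel (\<lambda>y. gauss \<sigma> t (Complex c y) * (F (Complex c y) / Complex c y))"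
    and intd: "integrable lborel (\<lambda>y. gauss \<sigma> t (Complex d y) * (F (Complex d y) / Complex d y))"
  shows "(\<integral>y. gauss \<sigma> t (Complex d y) * (F (Complex d y) / Complex d y) \<partial>lborel) -
     (\<integral>y. gauss \<sigma> t (Complex c y) * (F (Complex c y) / Complex c y) \<partial>lborel) = of_real (2 * pi) * F 0"
proof -
  define q where "q s = gauss \<sigma> t s * F s / s" for s
  have holo': "(\<lambda>s. gauss \<sigma> t s * F s) holomorphic_on S"
    unfolding gauss_def by (intro holomorphic_intros holo) auto
  have q_cont: "continuous_on {s. c \<le> Re s \<and> Re s \<le> d \<and> s \<noteq> 0} q"
    unfolding q_def
    by (intro continuous_intros continuous_on_subset[OF holomorphic_on_imp_continuous_on[OF holo']])
       (use S(3) in auto)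
  define M where "M = max (- c) d"
  \<comment> \<open>The last factor bounds \<open>F s / s\<close>: for \<open>norm s >= 1\<close>
    one has \<open>1 + norm s <= 2 * norm s\<close>.\<close>
  define E where "E T = exp (\<sigma>\<^sup>2 * M\<^sup>2 / 2 + M * \<bar>t\<bar>) * exp (- (\<sigma>\<^sup>2 * T\<^sup>2 / 2)) * (2 * \<bar>C\<bar>)" for T :: real
  have q_bound: "norm (q s) \<le> E T" if s: "c \<le> Re s" "Re s \<le> d" "\<bar>Im s\<bar> = T" "T \<ge> 1" for s T
  proof -
    have "norm s \<ge> 1" using abs_Im_le_cmod[of s] s by linarith
    have "norm (F s) \<le> \<bar>C\<bar> * (1 + norm s)"
      using lin[OF s(1,2)] by (rule order_trans) (intro mult_right_mono, auto)
    also have "\<dots> \<le> \<bar>C\<bar> * (2 * norm s)"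
      using \<open>norm s \<ge> 1\<close> by (intro mult_left_mono) auto
    finally have "norm (F s / s) \<le> 2 * \<bar>C\<bar>"
      using \<open>norm s \<ge> 1\<close> by (auto simp: norm_divide divide_le_eq)
    moreover have "\<bar>Re s\<bar> \<le> M" using s by (auto simp: M_def abs_le_iff le_max_iff_disj)
    then have "norm (gauss \<sigma> t s) \<le> exp (\<sigma>\<^sup>2 * M\<^sup>2 / 2 + M * \<bar>t\<bar>) * exp (- (\<sigma>\<^sup>2 * T\<^sup>2 / 2))"
      using norm_gauss_strip_le[of s M \<sigma> t] s(3) by auto
    ultimately have "norm (gauss \<sigma> t s) * norm (F s / s) \<le> E T"
      unfolding E_def by (intro mult_mono) auto
    then show ?thesis by (simp add: q_def norm_mult norm_divide)
  qed
  have E_lim: "(E \<longlongrightarrow> 0) at_top"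
    unfolding E_def using \<sigma> by real_asymp
  define I where "I x T = integral {-T..T} (\<lambda>y. q (Complex x y))" for x T
  have main: "norm (I d T - I c T - of_real (2 * pi) * F 0) \<le> 2 * (E T * (d - c))" if T: "T \<ge> 1" for T
  proof -
    let ?a = "Complex c (- T)" and ?b = "Complex d (- T)" and ?c = "Complex d T" and ?d = "Complex c T"
    have seg: "closed_segment ?a ?b \<subseteq> {s. c \<le> Re s \<and> Re s \<le> d \<and> \<bar>Im s\<bar> = T}"
       "closed_segment ?c ?d \<subseteq> {s. c \<le> Re s \<and> Re s \<le> d \<and> \<bar>Im s\<bar> = T}"
       "closed_segment ?b ?c \<subseteq> {s. Re s = d}" "closed_segment ?a ?d \<subseteq> {s. Re s = c}"
      using T cd by (auto simp: closed_segment_same_Re closed_segment_same_Im closed_segment_eq_real_ivl)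
    have cont: "continuous_on (closed_segment ?a ?b) q" "continuous_on (closed_segment ?b ?c) q"
        "continuous_on (closed_segment ?c ?d) q" "continuous_on (closed_segment ?d ?a) q"
      using seg T cd unfolding closed_segment_commute[of ?d ?a]
      by (intro continuous_on_subset[OF q_cont]; force)+
    note ci = cont[THEN contour_integrable_continuous_linepath]
    have E0: "E T \<ge> 0" by (simp add: E_def)
    have "norm (contour_integral (linepath ?a ?b) q) \<le> E T * norm (?b - ?a)"
      using seg(1) by (intro contour_integral_bound_linepath ci E0 q_bound[OF _ _ _ T]) auto
    then have 1: "norm (contour_integral (linepath ?a ?b) q) \<le> E T * (d - c)"
      using cd by (simp add: cmod_def)
    have "norm (contour_integral (linepath ?c ?d) q) \<le> E T * norm (?d - ?c)"
      using seg(2) by (intro contour_integral_bound_linepath ci E0 q_bound[OF _ _ _ T]) auto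
    then have 2: "norm (contour_integral (linepath ?c ?d) q) \<le> E T * (d - c)"
      using cd by (simp add: cmod_def)
    have 3: "contour_integral (linepath ?b ?c) q = \<i> * I d T"
      unfolding I_def using T by (intro contour_integral_linepath_same_Re) auto
    have "contour_integral (linepath ?a ?d) q = \<i> * I c T"
      unfolding I_def using T by (intro contour_integral_linepath_same_Re) auto
    then have 4: "contour_integral (linepath ?d ?a) q = - (\<i> * I c T)"
      using contour_integral_reverse_linepath[OF cont(4)[unfolded closed_segment_commute[of ?d ?a]]]
      by (metis minus_minus)
    have "((\<lambda>s. gauss \<sigma> t s * F s / (s - 0)) has_contour_integral
        (2 * pi * \<i> * winding_number (rectpath ?a ?c) 0 * (gauss \<sigma> t 0 * F 0))) (rectpath ?a ?c)"
    proof (rule Cauchy_integral_formula_convex_simple[OF S(2) holo'])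
      show "0 \<in> interior S" using S cd by (auto simp: interior_open)
      have "path_image (rectpath ?a ?c) = cbox ?a ?c - box ?a ?c"
        using T cd by (intro path_image_rectpath_cbox_minus_box) auto
      then show "path_image (rectpath ?a ?c) \<subseteq> S - {0}"
        using S(3) T cd by (auto simp: in_cbox_complex_iff in_box_complex_iff)
    qed auto
    moreover have "winding_number (rectpath ?a ?c) 0 = 1"
      using T cd by (intro winding_number_rectpath) (auto simp: in_box_complex_iff)
    ultimately have "(q has_contour_integral 2 * pi * \<i> * F 0) (rectpath ?a ?c)"
      by (simp add: q_def[abs_def] gauss_def)
    then have "contour_integral (rectpath ?a ?c) q = 2 * pi * \<i> * F 0"
      by (rule contour_integral_unique)
    moreover have "contour_integral (rectpath ?a ?c) q = contour_integral (linepath ?a ?b) q +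
        (\<i> * I d T + (contour_integral (linepath ?c ?d) q + - (\<i> * I c T)))"
      unfolding rectpath_def Let_def using ci by (simp add: 3 4)
    ultimately have "\<i> * (I d T - I c T - of_real (2 * pi) * F 0) =
        - (contour_integral (linepath ?a ?b) q + contour_integral (linepath ?c ?d) q)"
      by (simp add: algebra_simps)
    then have "norm (\<i> * (I d T - I c T - of_real (2 * pi) * F 0)) \<le>
       norm (contour_integral (linepath ?a ?b) q) + norm (contour_integral (linepath ?c ?d) q)"
      by (simp only: norm_minus_cancel norm_triangle_ineq)
    then show ?thesis using 1 2 by (simp add: norm_mult)
  qed
  have "((\<lambda>T. I d T - I c T - of_real (2 * pi) * F 0) \<longlongrightarrow> 0) at_top"
  proof (rule Lim_null_comparison)
    show "eventually (\<lambda>T. norm (I d T - I c T - of_real (2 * pi) * F 0) \<le> 2 * (E T * (d - c))) at_top"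
      using eventually_ge_at_top[of 1] by eventually_elim (rule main)
    show "((\<lambda>T. 2 * (E T * (d - c))) \<longlongrightarrow> 0) at_top"
      by (intro tendsto_mult_right_zero tendsto_mult_left_zero E_lim)
  qed
  moreover have "((\<lambda>T. I d T - I c T - of_real (2 * pi) * F 0) \<longlongrightarrow>
     (\<integral>y. q (Complex d y) \<partial>lborel) - (\<integral>y. q (Complex c y) \<partial>lborel) - of_real (2 * pi) * F 0) at_top"
    unfolding I_def using intc intd
    by (intro tendsto_intros integral_symmetric_tendsto) (simp_all add: q_def)
  ultimately have "0 = (\<integral>y. q (Complex d y) \<partial>lborel) - (\<integral>y. q (Complex c y) \<partial>lborel) - of_real (2 * pi) * F 0"
    by (rule tendsto_unique[OF trivial_limit_at_top_linorder])
  then show ?thesis by (simp add: q_def)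
qed

section \<open>Gaussian densities as an approximate identity\<close>

lemma std_normal_density_mult_exp_integrable:
  fixes a :: real
  shows "integrable lborel (\<lambda>z. std_normal_density z * exp (a * \<bar>z\<bar>))"
proof (rule Bochner_Integration.integrable_bound)
  \<comment> \<open>The constant comes from completing the square in
    \<open>(a + 1) * \<bar>z\<bar> - z\<^sup>2 / 2\<close>.\<close>
  show "integrable lborel (\<lambda>z. exp ((a + 1)\<^sup>2 / 2) * exp (- 1 * \<bar>z\<bar>))"
    by (intro integrable_mult_right integrable_exp_neg_abs) simp
  have "std_normal_density z * exp (a * \<bar>z\<bar>) \<le> exp ((a + 1)\<^sup>2 / 2) * exp (- 1 * \<bar>z\<bar>)" for z
  proof -
    have "1 \<le> sqrt (2 * pi)" using pi_gt3 by (intro real_le_rsqrt) simp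
    then have "1 / sqrt (2 * pi) \<le> 1" by simp
    then have "std_normal_density z * exp (a * \<bar>z\<bar>) \<le> 1 * exp (- z\<^sup>2 / 2) * exp (a * \<bar>z\<bar>)"
      unfolding std_normal_density_def by (intro mult_right_mono) auto
    also have "\<dots> = exp (- z\<^sup>2 / 2 + a * \<bar>z\<bar>)" unfolding exp_add by simp
    also have "\<dots> \<le> exp ((a + 1)\<^sup>2 / 2 + - 1 * \<bar>z\<bar>)"
    proof -
      have "0 \<le> (\<bar>z\<bar> - (a + 1))\<^sup>2" by simp
      then show ?thesis by (simp add: power2_diff algebra_simps)
    qed
    finally show ?thesis unfolding exp_add .
  qed
  then show "AE z in lborel. norm (std_normal_density z * exp (a * \<bar>z\<bar>)) \<le> norm (exp ((a + 1)\<^sup>2 / 2) * exp (- 1 * \<bar>z\<bar>))"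
    by (intro AE_I2) simp
qed measurable

lemma normal_convolution_eq:
  fixes f :: "real \<Rightarrow> complex"
  assumes "\<sigma> \<noteq> 0" "f \<in> borel_measurable borel"
  shows "(\<integral>\<tau>. of_real (normal_density 0 \<bar>\<sigma>\<bar> (t - \<tau>)) * f \<tau> \<partial>lborel) =
     (\<integral>z. of_real (std_normal_density z) * f (t + \<sigma> * z) \<partial>lborel)"
proof -
  have "\<bar>\<sigma>\<bar> * normal_density 0 \<bar>\<sigma>\<bar> (t - (t + \<sigma> * z)) = std_normal_density z" for z
    using assms(1) by (simp add: normal_density_def real_sqrt_mult power_mult_distrib)
  then have "\<bar>\<sigma>\<bar> *\<^sub>R (of_real (normal_density 0 \<bar>\<sigma>\<bar> (t - (t + \<sigma> * z))) * f (t + \<sigma> * z)) =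
      of_real (std_normal_density z) * f (t + \<sigma> * z)" for z
    by (simp add: scaleR_conv_of_real flip: mult.assoc of_real_mult)
  then show ?thesis
    by (subst lborel_integral_real_affine[OF assms(1), of _ t]) (simp flip: integral_scaleR_right)
qed

text \<open>At a jump \<open>f (t + \<sigma> z)\<close> alone tends to a one-sided limit. The
  symmetrized integrand h averages a point on the left of t with one on the right, so it converges
  pointwise to the midpoint value; \<sigma> <= 1 gives a dominating function independent of
  n.\<close>

lemma normal_convolution_tendsto:
  fixes f :: "real \<Rightarrow> complex"
  assumes f: "midpoint_regular f" and C: "\<And>t. norm (f t) \<le> C * exp (a * \<bar>t\<bar>)" and a: "a \<ge> 0"
  shows "(\<lambda>n. \<integral>\<tau>. of_real (normal_density 0 (1 / real (Suc n)) (t - \<tau>)) * f \<tau> \<partial>lborel) \<longlonglongrightarrow> f t"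
proof -
  have f_meas[measurable]: "f \<in> borel_measurable borel"
    by (rule midpoint_regular_borel_measurable[OF f])
  define \<sigma> where "\<sigma> n = 1 / real (Suc n)" for n
  have \<sigma>: "\<sigma> n > 0" "\<sigma> n \<le> 1" "\<sigma> n \<noteq> 0" for n by (auto simp: \<sigma>_def)
  have \<sigma>0: "\<sigma> \<longlonglongrightarrow> 0"
    unfolding \<sigma>_def using LIMSEQ_inverse_real_of_nat by (simp add: inverse_eq_divide)
  have C0: "C \<ge> 0" using C[of 0] order_trans[OF norm_ge_zero] by fastforce
  define w where "w z = C * exp (a * \<bar>t\<bar>) * (std_normal_density z * exp (a * \<bar>z\<bar>))" for z
  have w: "integrable lborel w"
    unfolding w_def by (intro integrable_mult_right std_normal_density_mult_exp_integrable)
  have bound: "norm (of_real (std_normal_density z) * f (t + r * z)) \<le> w z" if "\<bar>r\<bar> \<le> 1" for z r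
  proof -
    have "\<bar>t + r * z\<bar> \<le> \<bar>t\<bar> + 1 * \<bar>z\<bar>"
      using mult_right_mono[OF that, of "\<bar>z\<bar>"] by (intro order_trans[OF abs_triangle_ineq]) (simp add: abs_mult)
    then have "norm (f (t + r * z)) \<le> C * exp (a * (\<bar>t\<bar> + \<bar>z\<bar>))"
      using a C0 by (intro order_trans[OF C] mult_left_mono) (auto intro: mult_left_mono)
    then have "norm (f (t + r * z)) \<le> C * (exp (a * \<bar>t\<bar>) * exp (a * \<bar>z\<bar>))"
      by (simp add: distrib_left exp_add)
    from mult_left_mono[OF this, of "std_normal_density z"] show ?thesis
      by (simp add: w_def norm_mult mult_ac)
  qed
  have int: "integrable lborel (\<lambda>z. of_real (std_normal_density z) * f (t + r * z))" if "\<bar>r\<bar> \<le> 1" for r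
  proof (rule Bochner_Integration.integrable_bound[OF w])
    show "AE z in lborel. norm (of_real (std_normal_density z) * f (t + r * z)) \<le> norm (w z)"
      using bound[OF that] by (intro AE_I2) (force intro: order_trans[OF _ abs_ge_self])
  qed measurable
  define h where "h n z = of_real (std_normal_density z) * ((f (t + - \<sigma> n * z) + f (t + \<sigma> n * z)) / 2)" for n z
  have h_split: "h n z = (of_real (std_normal_density z) * f (t + - \<sigma> n * z) +
      of_real (std_normal_density z) * f (t + \<sigma> n * z)) / 2" for n z
    by (simp add: h_def distrib_left)
  have h_eq: "(\<integral>z. h n z \<partial>lborel) = (\<integral>\<tau>. of_real (normal_density 0 (\<sigma> n) (t - \<tau>)) * f \<tau> \<partial>lborel)" for n
  proof -
    have "(\<integral>z. h n z \<partial>lborel) = ((\<integral>z. of_real (std_normal_density z) * f (t + - \<sigma> n * z) \<partial>lborel) +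
       (\<integral>z. of_real (std_normal_density z) * f (t + \<sigma> n * z) \<partial>lborel)) / 2"
      unfolding h_split using int[of "- \<sigma> n"] int[of "\<sigma> n"] \<sigma>[of n] by simp
    then show ?thesis
      using normal_convolution_eq[of "- \<sigma> n" f t] normal_convolution_eq[of "\<sigma> n" f t] \<sigma>[of n] f_meas
      by simp
  qed
  have "(\<lambda>n. \<integral>z. h n z \<partial>lborel) \<longlonglongrightarrow> (\<integral>z. of_real (std_normal_density z) * f t \<partial>lborel)"
  proof (rule integral_dominated_convergence[OF _ _ w])
    show "AE z in lborel. norm (h n z) \<le> w z" for n
    proof (rule AE_I2)
      fix z
      have "norm (of_real (std_normal_density z) * f (t + - \<sigma> n * z) +
          of_real (std_normal_density z) * f (t + \<sigma> n * z)) \<le> w z + w z"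
        using \<sigma>[of n] by (intro order_trans[OF norm_triangle_ineq] add_mono bound) auto
      then show "norm (h n z) \<le> w z" unfolding h_split norm_divide by simp
    qed
    show "AE z in lborel. (\<lambda>n. h n z) \<longlonglongrightarrow> of_real (std_normal_density z) * f t"
    proof (rule AE_I2)
      fix z :: real
      have lim: "(\<lambda>n. t + - \<sigma> n * z) \<longlonglongrightarrow> t" "(\<lambda>n. t + \<sigma> n * z) \<longlonglongrightarrow> t"
        using tendsto_add[OF tendsto_const[of t] tendsto_mult_left_zero[OF tendsto_minus[OF \<sigma>0, simplified], of z]]
          tendsto_add[OF tendsto_const[of t] tendsto_mult_left_zero[OF \<sigma>0, of z]] by simp_all
      have "(\<lambda>n. (f (t + - \<sigma> n * z) + f (t + \<sigma> n * z)) / 2) \<longlonglongrightarrow> f t"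
      proof (cases z "0 :: real" rule: linorder_cases)
        case equal
        then show ?thesis by simp
      next
        case greater
        have "0 < \<sigma> n * z" for n using \<sigma>[of n] greater by simp
        then show ?thesis
          using lim by (intro midpoint_regular_limit[OF f]) (auto simp: filterlim_at \<sigma>(3))
      next
        case less
        have "\<sigma> n * z < 0" for n using \<sigma>[of n] less by (simp add: mult_less_0_iff)
        then have "(\<lambda>n. (f (t + \<sigma> n * z) + f (t + - \<sigma> n * z)) / 2) \<longlonglongrightarrow> f t"
          using lim by (intro midpoint_regular_limit[OF f]) (auto simp: filterlim_at \<sigma>(3))
        then show ?thesis by (simp add: add.commute)
      qed
      then show "(\<lambda>n. h n z) \<longlonglongrightarrow> of_real (std_normal_density z) * f t"
        unfolding h_def by (intro tendsto_mult_left)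
    qed
  qed (auto simp: h_def)
  moreover have "(\<integral>z. of_real (std_normal_density z) * f t \<partial>lborel) = f t"
    by (simp add: integral_complex_of_real)
  ultimately show ?thesis unfolding h_eq \<sigma>_def by simp
qed

section \<open>Comparison of the two determining functions\<close>

text \<open>Collects for a single line all that the comparison uses, so that it can be applied once
  on each side of the axis.\<close>

lemma laplace_stieltjes_vertical_line:
  fixes p c q :: real and F :: "complex \<Rightarrow> complex"
  assumes \<mu>: "determining_function \<mu>" and pcq: "p < c" "c < q" and sgn: "q < 0 \<or> 0 < p"
    and pq: "has_laplace_stieltjes \<mu> (of_real p) Lp" "has_laplace_stieltjes \<mu> (of_real q) Lq"
    and F: "\<And>s. Re s = c \<Longrightarrow> has_laplace_stieltjes \<mu> s (F s)"
  obtains m C0 where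
    "\<And>s. Re s = c \<Longrightarrow> norm (F s) \<le> C0 * norm s"
    "\<And>\<sigma> t. \<sigma> > 0 \<Longrightarrow> integrable lborel (\<lambda>y. gauss \<sigma> t (Complex c y) * (F (Complex c y) / Complex c y))"
    "\<And>\<sigma> t. \<sigma> > 0 \<Longrightarrow> (\<integral>y. gauss \<sigma> t (Complex c y) * (F (Complex c y) / Complex c y) \<partial>lborel) =
       of_real (2 * pi) * (\<integral>\<tau>. of_real (normal_density 0 \<sigma> (t - \<tau>)) * (\<mu> \<tau> - m) \<partial>lborel)"
    "\<And>t. (\<lambda>n. \<integral>\<tau>. of_real (normal_density 0 (1 / real (Suc n)) (t - \<tau>)) * (\<mu> \<tau> - m) \<partial>lborel)
       \<longlonglongrightarrow> \<mu> t - m"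
proof -
  obtain m C \<kappa> where \<kappa>: "\<kappa> > 0" and C: "\<And>t. norm (\<mu> t - m) \<le> C * exp (c * t - \<kappa> * \<bar>t\<bar>)"
    using laplace_stieltjes_two_sided_growth[OF \<mu> pcq sgn pq] by blast
  have reg: "midpoint_regular (\<lambda>t. \<mu> t - m)"
    by (intro midpoint_regular_diff_const determining_function_midpoint_regular \<mu>)
  have c0: "c \<noteq> 0" using pcq sgn by auto
  define \<Phi> where "\<Phi> s = (\<integral>t. exp (- s * of_real t) * (\<mu> t - m) \<partial>lborel)" for s
  have F_eq: "F s = s * \<Phi> s" if "Re s = c" for s
    unfolding \<Phi>_def by (rule laplace_stieltjes_eq_lebesgue[OF \<mu> \<kappa> C that F[OF that]])
  have \<Phi>: "F (Complex c y) / Complex c y = \<Phi> (Complex c y)" for y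
    using F_eq[of "Complex c y"] c0 by (simp add: complex_eq_iff[of _ 0])
  have int: "integrable lborel (\<lambda>t. of_real (exp (- c * t)) * (\<mu> t - m))"
    using exp_mult_determining_function_integrable(2)[OF \<mu> \<kappa> C, of "of_real c"]
    unfolding exp_of_real[symmetric] by simp
  have C0: "C \<ge> 0" using C[of 0] order_trans[OF norm_ge_zero] by fastforce
  show ?thesis
  proof (rule that)
    \<comment> \<open>The constant is the L1 norm of the weighted function
      \<open>exp (- c * t) * (\<mu> t - m)\<close>, the same for all points of the line.\<close>
    show "norm (F s) \<le> (\<integral>t. exp (- c * t) * norm (\<mu> t - m) \<partial>lborel) * norm s" if "Re s = c" for s
    proof -
      have "norm (\<Phi> s) \<le> (\<integral>t. norm (exp (- s * of_real t) * (\<mu> t - m)) \<partial>lborel)"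
        unfolding \<Phi>_def by (rule integral_norm_bound)
      also have "\<dots> = (\<integral>t. exp (- c * t) * norm (\<mu> t - m) \<partial>lborel)"
        by (simp add: norm_mult that)
      finally show ?thesis using F_eq[OF that] by (simp add: norm_mult mult.commute mult_left_mono)
    qed
    show "integrable lborel (\<lambda>y. gauss \<sigma> t (Complex c y) * (F (Complex c y) / Complex c y))"
      if "\<sigma> > 0" for \<sigma> t
      unfolding \<Phi> unfolding \<Phi>_def
      by (rule gauss_laplace(1)[OF that int midpoint_regular_borel_measurable[OF reg]])
    show "(\<integral>y. gauss \<sigma> t (Complex c y) * (F (Complex c y) / Complex c y) \<partial>lborel) =
       of_real (2 * pi) * (\<integral>\<tau>. of_real (normal_density 0 \<sigma> (t - \<tau>)) * (\<mu> \<tau> - m) \<partial>lborel)"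
      if "\<sigma> > 0" for \<sigma> t
      unfolding \<Phi> unfolding \<Phi>_def
      by (rule gauss_laplace(2)[OF that int midpoint_regular_borel_measurable[OF reg]])
    show "(\<lambda>n. \<integral>\<tau>. of_real (normal_density 0 (1 / real (Suc n)) (t - \<tau>)) * (\<mu> \<tau> - m) \<partial>lborel)
       \<longlonglongrightarrow> \<mu> t - m" for t
    proof (rule normal_convolution_tendsto[OF reg])
      show "norm (\<mu> t - m) \<le> C * exp (\<bar>c\<bar> * \<bar>t\<bar>)" for t
      proof -
        have "c * t - \<kappa> * \<bar>t\<bar> \<le> \<bar>c\<bar> * \<bar>t\<bar>"
          using abs_ge_self[of "c * t"] mult_nonneg_nonneg[OF less_imp_le[OF \<kappa>] abs_ge_zero[of t]]
          by (simp add: abs_mult)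
        then show ?thesis using C0 by (intro order_trans[OF C] mult_left_mono) auto
      qed
    qed simp
  qed
qed

theorem theorem3p2:
  fixes F :: "complex \<Rightarrow> complex" and \<mu>\<^sub>l \<mu>\<^sub>r :: "real \<Rightarrow> complex" and a b :: ereal
  assumes "a < 0" and "0 < b"
    and "laplace_pair F \<mu>\<^sub>l \<mu>\<^sub>r a b"
    and "F holomorphic_on vertical_strip a b"
    and "phragmen_lindelof F a b"
  shows "\<forall>t. \<mu>\<^sub>l t = \<mu>\<^sub>r t"
proof -
  note holo = assms(4)
  have \<mu>: "determining_function \<mu>\<^sub>l" "determining_function \<mu>\<^sub>r"
    and Ll: "\<And>s. s \<in> vertical_strip a 0 \<Longrightarrow> has_laplace_stieltjes \<mu>\<^sub>l s (F s)"
    and Lr: "\<And>s. s \<in> vertical_strip 0 b \<Longrightarrow> has_laplace_stieltjes \<mu>\<^sub>r s (F s)"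
    using assms(3) unfolding laplace_pair_def by blast+
  obtain p where p: "a < ereal p" "p < 0"
    using ereal_dense2[OF assms(1)] by (auto simp flip: zero_ereal_def)
  obtain q where q: "0 < q" "ereal q < b"
    using ereal_dense2[OF assms(2)] by (auto simp flip: zero_ereal_def)
  \<comment> \<open>Halving leaves room on both sides of each line: p < c < c/2 < 0 and 0 < d/2 < d
    < q provide the bracketing points of convergence.\<close>
  define c d where "c = p / 2" and "d = q / 2"
  have cd: "p < c" "c < 0" "0 < d" "d < q" using p q by (auto simp: c_def d_def)
  have left: "s \<in> vertical_strip a 0" if "p \<le> Re s" "Re s < 0" for s
    using that p less_le_trans[of a p "Re s"] by (auto simp: vertical_strip_def)
  have right: "s \<in> vertical_strip 0 b" if "0 < Re s" "Re s \<le> q" for s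
    using that q le_less_trans[of "Re s" q b] by (auto simp: vertical_strip_def)
  define S where "S = {s. Re s > p} \<inter> {s. Re s < q}"
  have S: "open S" "convex S" "{s. c \<le> Re s \<and> Re s \<le> d} \<subseteq> S"
    unfolding S_def using cd
    by (auto intro!: open_Int convex_Int open_halfspace_Re_gt open_halfspace_Re_lt
        convex_halfspace_Re_gt convex_halfspace_Re_lt)
  have "S \<subseteq> vertical_strip a b"
    using p q less_trans[of a p] less_trans[of _ q b] by (auto simp: S_def vertical_strip_def)
  then have holoS: "F holomorphic_on S" using holo holomorphic_on_subset by blast

  obtain m C where l: "\<And>s. Re s = c \<Longrightarrow> norm (F s) \<le> C * norm s"
    "\<And>\<sigma> t. \<sigma> > 0 \<Longrightarrow> integrable lborel (\<lambda>y. gauss \<sigma> t (Complex c y) * (F (Complex c y) / Complex c y))"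
    "\<And>\<sigma> t. \<sigma> > 0 \<Longrightarrow> (\<integral>y. gauss \<sigma> t (Complex c y) * (F (Complex c y) / Complex c y) \<partial>lborel) =
       of_real (2 * pi) * (\<integral>\<tau>. of_real (normal_density 0 \<sigma> (t - \<tau>)) * (\<mu>\<^sub>l \<tau> - m) \<partial>lborel)"
    "\<And>t. (\<lambda>n. \<integral>\<tau>. of_real (normal_density 0 (1 / real (Suc n)) (t - \<tau>)) * (\<mu>\<^sub>l \<tau> - m) \<partial>lborel)
       \<longlonglongrightarrow> \<mu>\<^sub>l t - m"
  proof (rule laplace_stieltjes_vertical_line[OF \<mu>(1), of p c "c / 2" _ _ F])
    show "has_laplace_stieltjes \<mu>\<^sub>l (of_real p) (F (of_real p))"
      "has_laplace_stieltjes \<mu>\<^sub>l (of_real (c / 2)) (F (of_real (c / 2)))"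
      using p cd by (auto intro!: Ll left)
    show "has_laplace_stieltjes \<mu>\<^sub>l s (F s)" if "Re s = c" for s
      using that cd by (intro Ll left) auto
  qed (use p cd in auto)
  obtain m' C' where r: "\<And>s. Re s = d \<Longrightarrow> norm (F s) \<le> C' * norm s"
    "\<And>\<sigma> t. \<sigma> > 0 \<Longrightarrow> integrable lborel (\<lambda>y. gauss \<sigma> t (Complex d y) * (F (Complex d y) / Complex d y))"
    "\<And>\<sigma> t. \<sigma> > 0 \<Longrightarrow> (\<integral>y. gauss \<sigma> t (Complex d y) * (F (Complex d y) / Complex d y) \<partial>lborel) =
       of_real (2 * pi) * (\<integral>\<tau>. of_real (normal_density 0 \<sigma> (t - \<tau>)) * (\<mu>\<^sub>r \<tau> - m') \<partial>lborel)"
    "\<And>t. (\<lambda>n. \<integral>\<tau>. of_real (normal_density 0 (1 / real (Suc n)) (t - \<tau>)) * (\<mu>\<^sub>r \<tau> - m') \<partial>lborel)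
       \<longlonglongrightarrow> \<mu>\<^sub>r t - m'"
  proof (rule laplace_stieltjes_vertical_line[OF \<mu>(2), of "d / 2" d q _ _ F])
    show "has_laplace_stieltjes \<mu>\<^sub>r (of_real (d / 2)) (F (of_real (d / 2)))"
      "has_laplace_stieltjes \<mu>\<^sub>r (of_real q) (F (of_real q))"
      using q cd by (auto intro!: Lr right)
    show "has_laplace_stieltjes \<mu>\<^sub>r s (F s)" if "Re s = d" for s
      using that cd by (intro Lr right) auto
  qed (use q cd in auto)

  have edges: "norm (F s) \<le> max C C' * norm s" if "Re s = c \<or> Re s = d" for s
    using that l(1)[of s] r(1)[of s] mult_right_mono[of C "max C C'" "norm s"]
      mult_right_mono[of C' "max C C'" "norm s"] by auto
  have "a < ereal c" "ereal d < b"
    using p q cd less_trans[of a p c] less_trans[of d q b] by auto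
  from phragmen_lindelof_linear_bound[OF holo assms(5) this(1) _ this(2) edges] cd
  obtain C'' where lin: "\<And>s. c \<le> Re s \<Longrightarrow> Re s \<le> d \<Longrightarrow> norm (F s) \<le> C'' * (1 + norm s)"
    by auto
  have shift: "(\<integral>\<tau>. of_real (normal_density 0 \<sigma> (t - \<tau>)) * (\<mu>\<^sub>r \<tau> - m') \<partial>lborel) -
      (\<integral>\<tau>. of_real (normal_density 0 \<sigma> (t - \<tau>)) * (\<mu>\<^sub>l \<tau> - m) \<partial>lborel) = F 0" if "\<sigma> > 0" for \<sigma> t
    using contour_shift_gauss[OF that cd(2,3) S holoS lin l(2)[OF that] r(2)[OF that], of t]
    unfolding l(3)[OF that] r(3)[OF that] right_diff_distrib[symmetric] by simp
  \<comment> \<open>By \<open>shift\<close> the difference of the convolutions is a constant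
    sequence in n, so its limit equals that constant at every t, jumps included.\<close>
  have diff: "(\<mu>\<^sub>r t - m') - (\<mu>\<^sub>l t - m) = F 0" for t
  proof -
    have "(\<lambda>n::nat. F 0) \<longlonglongrightarrow> (\<mu>\<^sub>r t - m') - (\<mu>\<^sub>l t - m)"
      using tendsto_diff[OF r(4) l(4), of t t] by (subst (asm) shift) auto
    then show ?thesis by (simp add: LIMSEQ_const_iff)
  qed
  have "\<mu>\<^sub>l 0 = 0" "\<mu>\<^sub>r 0 = 0"
    using \<mu> by (auto simp: determining_function_def normalized_def)
  then have "\<mu>\<^sub>r t = \<mu>\<^sub>l t" for t
    using diff[of 0] diff[of t] by (simp add: algebra_simps)
  then show ?thesis by simp
qed

end
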